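(* Let $\Lambda=\Lambda(\mathbb{F}_n)$ be the space of Schreier graphs of $\mathbb{F}_n=\langle a_1,\ldots,a_n\rangle$, let $\Omega$ be the space of connected rooted $2n$-regular graphs, and let $f:\Lambda\to\Omega$ be the forgetful map sending a Schreier graph to its underlying unlabeled, undirected rooted graph. Let $\Gamma\in\Omega$ be an infinite vertex-transitive nonunimodular graph. Then $f^{-1}(\Gamma)$, the space of Schreier structures over $\Gamma$, is a closed invariant subspace of $\Lambda$ which does not support an invariant measure, i.e. there is no invariant probability measure $\mu$ on $\Lambda$ with $\mu(f^{-1}(\Gamma))=1$.
   Context: Graphs may have loops and multiple edges; a loop contributes $2$ to the degree. $\Omega$ is the set of root-preserving isomorphism classes of connected rooted graphs $(\Gamma,x)$ in which every vertex has degree $2n$. A Schreier graph is such a rooted graph whose edges are oriented and labeled with $a_1,\ldots,a_n$ so that every vertex has, for each $i$, precisely one incoming and one outgoing edge labeled $a_i$; $\Lambda$ is the set of isomorphism classes of Schreier graphs, isomorphisms preserving root, labels and orientations. Both spaces carry the compact topology whose base is given by the cylinder sets $\{(\Gamma,x): U_r(x)\cong U\}$, where $U_r(x)$ is the $r$-neighborhood of the root (labeled in the case of $\Lambda$). The group $\mathbb{F}_n$ acts on $\Lambda$ by moving the root along the path labeled by a word in the generators (following an edge labeled $a_i$ forwards for $a_i$ and backwards for $a_i^{-1}$); under the bijection between $\Lambda$ and the subgroups $H$ of $\mathbb{F}_n$ this is conjugation $H\mapsto gHg^{-1}$. A subspace of $\Lambda$ is invariant if it is preserved by this action, and a Borel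 probability measure on $\Lambda$ is invariant if it is preserved by this action (equivalently, if the left and right counting measures on the equivalence relation of being isomorphic as unrooted Schreier graphs coincide). A vertex-transitive connected graph $\Gamma$ is nonunimodular if its automorphism group is not unimodular, i.e. if there are vertices $x,y$ of $\Gamma$ with $|\mathrm{Aut}_x(\Gamma)\cdot y|\ne|\mathrm{Aut}_y(\Gamma)\cdot x|$, where $\mathrm{Aut}_x(\Gamma)$ is the stabilizer of $x$ in $\mathrm{Aut}(\Gamma)$ (automorphisms of the unlabeled graph). *)

theory Defs
  imports
    "HOL-Probability.Probability"
    "HOL-Library.Multiset"
    "HOL-Algebra.Group"
begin

section \<open>Rooted multigraphs\<close>

text \<open>
  The multiset \<open>ends G e\<close> consists of the two endpoints of \<open>e\<close>; a loop at \<open>v\<close> has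
  \<open>ends G e = {#v, v#}\<close>. Only the values of \<open>ends\<close> on \<open>edges G\<close> are meaningful, and
  isomorphisms ignore all other values.
\<close>

record ('v, 'e) rooted_graph =
  verts :: "'v set"
  edges :: "'e set"
  ends :: "'e \<Rightarrow> 'v multiset"
  root_vertex :: 'v

definition multigraph :: "('v, 'e, 'z) rooted_graph_scheme \<Rightarrow> bool" where
  "multigraph G \<longleftrightarrow> (\<forall>e\<in>edges G. size (ends G e) = 2 \<and> set_mset (ends G e) \<subseteq> verts G)"

definition incident_edges :: "('v, 'e, 'z) rooted_graph_scheme \<Rightarrow> 'v \<Rightarrow> 'e set" where
  "incident_edges G v = {e \<in> edges G. v \<in># ends G e}"

text \<open>Since \<open>count {#v, v#} v = 2\<close>, a loop contributes 2 to the degree.\<close>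

definition regular_graph :: "nat \<Rightarrow> ('v, 'e, 'z) rooted_graph_scheme \<Rightarrow> bool" where
  "regular_graph d G \<longleftrightarrow> (\<forall>v\<in>verts G. finite (incident_edges G v) \<and>
     (\<Sum>e\<in>incident_edges G v. count (ends G e) v) = d)"

definition adjacency :: "('v, 'e, 'z) rooted_graph_scheme \<Rightarrow> ('v \<times> 'v) set" where
  "adjacency G = {(u, v). \<exists>e\<in>edges G. ends G e = {#u, v#}}"

definition connected_graph :: "('v, 'e, 'z) rooted_graph_scheme \<Rightarrow> bool" where
  "connected_graph G \<longleftrightarrow> (\<forall>u\<in>verts G. \<forall>v\<in>verts G. (u, v) \<in> (adjacency G)\<^sup>*)"

definition regular_rooted_graph :: "nat \<Rightarrow> ('v, 'e, 'z) rooted_graph_scheme \<Rightarrow> bool" where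
  "regular_rooted_graph d G \<longleftrightarrow>
     multigraph G \<and> root_vertex G \<in> verts G \<and> connected_graph G \<and> regular_graph d G"

text \<open>Isomorphisms of unrooted graphs are pairs of a vertex map and an edge map.\<close>

definition graph_iso :: "('v \<Rightarrow> 'w) \<Rightarrow> ('e \<Rightarrow> 'f) \<Rightarrow> ('v, 'e, 'y) rooted_graph_scheme \<Rightarrow>
    ('w, 'f, 'z) rooted_graph_scheme \<Rightarrow> bool" where
  "graph_iso \<phi> \<psi> G H \<longleftrightarrow>
     bij_betw \<phi> (verts G) (verts H) \<and> bij_betw \<psi> (edges G) (edges H) \<and>
     (\<forall>e\<in>edges G. ends H (\<psi> e) = image_mset \<phi> (ends G e))"

definition rooted_iso :: "('v \<Rightarrow> 'w) \<Rightarrow> ('e \<Rightarrow> 'f) \<Rightarrow> ('v, 'e, 'y) rooted_graph_scheme \<Rightarrow>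
    ('w, 'f, 'z) rooted_graph_scheme \<Rightarrow> bool" where
  "rooted_iso \<phi> \<psi> G H \<longleftrightarrow> graph_iso \<phi> \<psi> G H \<and> \<phi> (root_vertex G) = root_vertex H"

definition vertex_transitive :: "('v, 'e, 'z) rooted_graph_scheme \<Rightarrow> bool" where
  "vertex_transitive G \<longleftrightarrow>
     (\<forall>x\<in>verts G. \<forall>y\<in>verts G. \<exists>\<phi> \<psi>. graph_iso \<phi> \<psi> G G \<and> \<phi> x = y)"

definition stabilizer_orbit :: "('v, 'e, 'z) rooted_graph_scheme \<Rightarrow> 'v \<Rightarrow> 'v \<Rightarrow> 'v set" where
  "stabilizer_orbit G x y = {\<phi> y | \<phi> \<psi>. graph_iso \<phi> \<psi> G G \<and> \<phi> x = x}"

text \<open>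
  In a connected locally finite graph the orbits below are finite, because they are contained in
  balls; so \<open>card\<close> is the true cardinality.
\<close>

definition nonunimodular :: "('v, 'e, 'z) rooted_graph_scheme \<Rightarrow> bool" where
  "nonunimodular G \<longleftrightarrow> (\<exists>x\<in>verts G. \<exists>y\<in>verts G.
     card (stabilizer_orbit G x y) \<noteq> card (stabilizer_orbit G y x))"

definition ball_vertices :: "nat \<Rightarrow> ('v, 'e, 'z) rooted_graph_scheme \<Rightarrow> 'v set" where
  "ball_vertices r G = {v. \<exists>k\<le>r. (root_vertex G, v) \<in> adjacency G ^^ k}"

text \<open>
  The subgraph induced on the vertices at distance at most \<open>r\<close> from the root. Any additional
  structure of \<open>G\<close> (orientation and labels) is kept.
\<close>

definition neighborhood ::
  "nat \<Rightarrow> ('v, 'e, 'z) rooted_graph_scheme \<Rightarrow> ('v, 'e, 'z) rooted_graph_scheme" where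
  "neighborhood r G = G\<lparr>verts := ball_vertices r G,
     edges := {e \<in> edges G. set_mset (ends G e) \<subseteq> ball_vertices r G}\<rparr>"

section \<open>Schreier graphs\<close>

text \<open>The generators \<open>a\<^sub>1, \<dots>, a\<^sub>n\<close> are numbered \<open>0, \<dots>, n - 1\<close>.\<close>

record ('v, 'e) schreier_graph = "('v, 'e) rooted_graph" +
  tail :: "'e \<Rightarrow> 'v"
  head :: "'e \<Rightarrow> 'v"
  label :: "'e \<Rightarrow> nat"

definition schreier :: "nat \<Rightarrow> ('v, 'e) schreier_graph \<Rightarrow> bool" where
  "schreier n G \<longleftrightarrow> regular_rooted_graph (2 * n) G \<and>
     (\<forall>e\<in>edges G. ends G e = {#tail G e, head G e#} \<and> label G e < n) \<and>
     (\<forall>v\<in>verts G. \<forall>i<n. (\<exists>!e. e \<in> edges G \<and> tail G e = v \<and> label G e = i) \<and>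
                          (\<exists>!e. e \<in> edges G \<and> head G e = v \<and> label G e = i))"

definition schreier_iso :: "('v \<Rightarrow> 'w) \<Rightarrow> ('e \<Rightarrow> 'f) \<Rightarrow> ('v, 'e) schreier_graph \<Rightarrow>
    ('w, 'f) schreier_graph \<Rightarrow> bool" where
  "schreier_iso \<phi> \<psi> G H \<longleftrightarrow> rooted_iso \<phi> \<psi> G H \<and>
     (\<forall>e\<in>edges G. tail H (\<psi> e) = \<phi> (tail G e) \<and> head H (\<psi> e) = \<phi> (head G e) \<and>
                   label H (\<psi> e) = label G e)"

section \<open>The spaces \<open>\<Omega>\<close> and \<open>\<Lambda>\<close>\<close>

text \<open>
  A connected locally finite graph has countably many vertices and edges, so every isomorphism
  class, of finite as well as of infinite graphs, has a representative whose vertices and edges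
  are natural numbers.
\<close>

definition Omega_rel :: "nat \<Rightarrow> (nat, nat) rooted_graph rel" where
  "Omega_rel n = {(G, H). regular_rooted_graph (2 * n) G \<and> regular_rooted_graph (2 * n) H \<and>
     (\<exists>\<phi> \<psi>. rooted_iso \<phi> \<psi> G H)}"

definition Omega :: "nat \<Rightarrow> (nat, nat) rooted_graph set set" where
  "Omega n = {G. regular_rooted_graph (2 * n) G} // Omega_rel n"

definition Lambda_rel :: "nat \<Rightarrow> (nat, nat) schreier_graph rel" where
  "Lambda_rel n = {(G, H). schreier n G \<and> schreier n H \<and> (\<exists>\<phi> \<psi>. schreier_iso \<phi> \<psi> G H)}"

definition Lambda :: "nat \<Rightarrow> (nat, nat) schreier_graph set set" where
  "Lambda n = {G. schreier n G} // Lambda_rel n"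

text \<open>\<open>rooted_graph.truncate\<close> drops the fields \<open>tail\<close>, \<open>head\<close> and \<open>label\<close>.\<close>

definition forget :: "nat \<Rightarrow> (nat, nat) schreier_graph set \<Rightarrow> (nat, nat) rooted_graph set" where
  "forget n C = (\<Union>G\<in>C. Omega_rel n `` {rooted_graph.truncate G})"

definition schreier_structures ::
  "nat \<Rightarrow> (nat, nat) rooted_graph set \<Rightarrow> (nat, nat) schreier_graph set set" where
  "schreier_structures n \<Gamma> = {C \<in> Lambda n. forget n C = \<Gamma>}"

definition cylinder ::
  "nat \<Rightarrow> nat \<Rightarrow> (nat, nat) schreier_graph \<Rightarrow> (nat, nat) schreier_graph set set" where
  "cylinder n r U = {C \<in> Lambda n. \<exists>G\<in>C. \<exists>\<phi> \<psi>. schreier_iso \<phi> \<psi> (neighborhood r G) U}"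

definition Lambda_topology :: "nat \<Rightarrow> (nat, nat) schreier_graph set topology" where
  "Lambda_topology n = topology_generated_by {cylinder n r U | r U. True}"

definition Lambda_borel :: "nat \<Rightarrow> (nat, nat) schreier_graph set measure" where
  "Lambda_borel n = sigma (Lambda n) {S. openin (Lambda_topology n) S}"

section \<open>The free group and its action\<close>

text \<open>
  The letter \<open>(i, True)\<close> stands for the generator with number \<open>i\<close>, and \<open>(i, False)\<close> for its
  inverse. The elements of the free group are the reduced words.
\<close>

type_synonym letter = "nat \<times> bool"

fun flip :: "letter \<Rightarrow> letter" where
  "flip (i, b) = (i, \<not> b)"

definition reduced_word :: "letter list \<Rightarrow> bool" where
  "reduced_word w \<longleftrightarrow> successively (\<lambda>l m. m \<noteq> flip l) w"

fun push :: "letter \<Rightarrow> letter list \<Rightarrow> letter list" where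
  "push l [] = [l]"
| "push l (m # w) = (if m = flip l then w else l # m # w)"

definition free_group :: "nat \<Rightarrow> letter list monoid" where
  "free_group n = \<lparr>carrier = {w. set w \<subseteq> {..<n} \<times> UNIV \<and> reduced_word w},
     mult = (\<lambda>u v. foldr push u v), one = []\<rparr>"

fun move_root :: "letter \<Rightarrow> ('v, 'e) schreier_graph \<Rightarrow> ('v, 'e) schreier_graph" where
  "move_root (i, True) G = G\<lparr>root_vertex :=
     head G (THE e. e \<in> edges G \<and> tail G e = root_vertex G \<and> label G e = i)\<rparr>"
| "move_root (i, False) G = G\<lparr>root_vertex :=
     tail G (THE e. e \<in> edges G \<and> head G e = root_vertex G \<and> label G e = i)\<rparr>"

text \<open>
  The last letter of the word is followed first, so that this is a left action. It corresponds to
  \<open>H \<mapsto> g H g\<^sup>-\<^sup>1\<close> if a subgroup \<open>H\<close> is identified with the Schreier graph on the cosets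
  \<open>x H\<close>, with an edge labeled \<open>a\<close> from \<open>x H\<close> to \<open>a x H\<close> and with root \<open>H\<close>.
\<close>

definition act :: "nat \<Rightarrow> letter list \<Rightarrow> (nat, nat) schreier_graph set \<Rightarrow>
    (nat, nat) schreier_graph set" where
  "act n g C = (\<Union>G\<in>C. Lambda_rel n `` {foldr move_root g G})"

definition invariant_subspace :: "nat \<Rightarrow> (nat, nat) schreier_graph set set \<Rightarrow> bool" where
  "invariant_subspace n S \<longleftrightarrow> S \<subseteq> Lambda n \<and> (\<forall>g\<in>carrier (free_group n). act n g ` S = S)"

definition invariant_probability :: "nat \<Rightarrow> (nat, nat) schreier_graph set measure \<Rightarrow> bool" where
  "invariant_probability n \<mu> \<longleftrightarrow> prob_space \<mu> \<and> sets \<mu> = sets (Lambda_borel n) \<and>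
     (\<forall>g\<in>carrier (free_group n). distr \<mu> \<mu> (act n g) = \<mu>)"

section \<open>Well-definedness\<close>

lemma flip_flip [simp]: "flip (flip l) = l"
  by (cases l) auto

lemma flip_neq [simp]: "flip l \<noteq> l" "l \<noteq> flip l"
  by (cases l; auto)+

lemma reduced_push: "reduced_word w \<Longrightarrow> reduced_word (push l w)"
  by (cases w) (auto simp: reduced_word_def successively_Cons split: list.splits)

lemma push_push_flip: "reduced_word w \<Longrightarrow> push l (push (flip l) w) = w"
proof (cases w)
  case (Cons m v)
  assume "reduced_word w"
  then show ?thesis
    unfolding Cons by (cases v) (auto simp: reduced_word_def simp del: flip.simps)
qed auto

lemma push_set: "set (push l w) \<subseteq> insert l (set w)"
  by (cases w) auto

lemma fst_flip [simp]: "fst (flip l) = fst l"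
  by (cases l) auto

lemma reduced_foldr_push: "reduced_word w \<Longrightarrow> reduced_word (foldr push u w)"
  by (induction u) (auto intro: reduced_push)

lemma foldr_push_set: "set (foldr push u w) \<subseteq> set u \<union> set w"
  by (induction u) (use push_set in fastforce)+

lemma foldr_push_push:
  assumes "reduced_word w"
  shows "foldr push (push l v) w = push l (foldr push v w)"
proof (cases v)
  case (Cons m v')
  show ?thesis
    using push_push_flip[of "foldr push v' w" l] reduced_foldr_push[OF assms]
    by (auto simp: Cons)
qed auto

lemma foldr_push_reduced: "reduced_word u \<Longrightarrow> foldr push u [] = u"
proof (induction u)
  case (Cons l u)
  then have "reduced_word u" by (auto simp: reduced_word_def successively_Cons)
  with Cons show ?case by (cases u) (auto simp: reduced_word_def)
qed auto

lemma foldr_push_flip: "reduced_word w \<Longrightarrow> foldr push (rev (map flip u)) (foldr push u w) = w"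
proof (induction u arbitrary: w)
  case (Cons l u)
  then show ?case
    using push_push_flip[of "foldr push u w" "flip l"] by (simp add: reduced_foldr_push)
qed auto

lemma reduced_rev_flip: "reduced_word u \<Longrightarrow> reduced_word (rev (map flip u))"
  by (simp add: reduced_word_def successively_map)
    (erule successively_mono, metis flip_flip)

lemma group_free_group: "group (free_group n)"
proof (rule groupI)
  fix x y z assume *: "x \<in> carrier (free_group n)" "y \<in> carrier (free_group n)"
    "z \<in> carrier (free_group n)"
  then have z: "reduced_word z" by (auto simp: free_group_def)
  have "foldr push (foldr push x y) z = foldr push x (foldr push y z)"
    by (induction x) (auto simp: foldr_push_push[OF z])
  then show "x \<otimes>\<^bsub>free_group n\<^esub> y \<otimes>\<^bsub>free_group n\<^esub> z = x \<otimes>\<^bsub>free_group n\<^esub> (y \<otimes>\<^bsub>free_group n\<^esub> z)"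
    by (simp add: free_group_def)
next
  fix x assume x: "x \<in> carrier (free_group n)"
  have "rev (map flip x) \<in> carrier (free_group n)"
    using x reduced_rev_flip[of x] by (fastforce simp: free_group_def)
  moreover have "rev (map flip x) \<otimes>\<^bsub>free_group n\<^esub> x = \<one>\<^bsub>free_group n\<^esub>"
    using x foldr_push_flip[of "[]" x] foldr_push_reduced[of x]
    by (auto simp: free_group_def reduced_word_def)
  ultimately show "\<exists>y\<in>carrier (free_group n). y \<otimes>\<^bsub>free_group n\<^esub> x = \<one>\<^bsub>free_group n\<^esub>"
    by blast
next
  fix x y assume "x \<in> carrier (free_group n)" "y \<in> carrier (free_group n)"
  then show "x \<otimes>\<^bsub>free_group n\<^esub> y \<in> carrier (free_group n)"
    using foldr_push_set[of x y] by (auto simp: free_group_def reduced_foldr_push)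
qed (auto simp: free_group_def reduced_word_def)

lemma graph_iso_refl: "graph_iso id id G G"
  by (simp add: graph_iso_def)

lemma graph_iso_trans:
  assumes "graph_iso \<phi> \<psi> G H" "graph_iso \<phi>' \<psi>' H K"
  shows "graph_iso (\<phi>' \<circ> \<phi>) (\<psi>' \<circ> \<psi>) G K"
  using assms unfolding graph_iso_def
  by (auto simp: multiset.map_comp intro: bij_betw_trans dest: bij_betwE)

lemma graph_iso_sym:
  assumes "graph_iso \<phi> \<psi> G H" "multigraph G"
  shows "graph_iso (inv_into (verts G) \<phi>) (inv_into (edges G) \<psi>) H G"
proof -
  have \<phi>: "bij_betw \<phi> (verts G) (verts H)" and \<psi>: "bij_betw \<psi> (edges G) (edges H)"
    using assms by (auto simp: graph_iso_def)
  have "ends G (inv_into (edges G) \<psi> e) = image_mset (inv_into (verts G) \<phi>) (ends H e)"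
    if e: "e \<in> edges H" for e
  proof -
    let ?e = "inv_into (edges G) \<psi> e"
    have e': "?e \<in> edges G" "\<psi> ?e = e"
      using e \<psi> by (auto simp: bij_betw_def inv_into_into f_inv_into_f)
    then have "ends H e = image_mset \<phi> (ends G ?e)"
      using assms by (metis graph_iso_def)
    then have "image_mset (inv_into (verts G) \<phi>) (ends H e)
        = image_mset (\<lambda>x. inv_into (verts G) \<phi> (\<phi> x)) (ends G ?e)"
      by (simp add: multiset.map_comp comp_def)
    also have "\<dots> = image_mset (\<lambda>x. x) (ends G ?e)"
      using assms(2) e' \<phi>
      by (intro image_mset_cong inv_into_f_f) (auto simp: multigraph_def bij_betw_def)
    finally show ?thesis by simp
  qed
  then show ?thesis
    using \<phi> \<psi> by (auto simp: graph_iso_def bij_betw_inv_into)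
qed

lemma equiv_Omega_rel: "equiv {G. regular_rooted_graph (2 * n) G} (Omega_rel n)"
proof (rule equivI)
  show "refl_on {G. regular_rooted_graph (2 * n) G} (Omega_rel n)"
    using graph_iso_refl by (fastforce simp: refl_on_def Omega_rel_def rooted_iso_def)
  show "sym (Omega_rel n)"
  proof (rule symI)
    fix G H assume "(G, H) \<in> Omega_rel n"
    then obtain \<phi> \<psi> where *: "regular_rooted_graph (2 * n) G" "regular_rooted_graph (2 * n) H"
      "rooted_iso \<phi> \<psi> G H" by (auto simp: Omega_rel_def)
    then have "rooted_iso (inv_into (verts G) \<phi>) (inv_into (edges G) \<psi>) H G"
      using graph_iso_sym[of \<phi> \<psi> G H]
      by (auto simp: rooted_iso_def regular_rooted_graph_def graph_iso_def bij_betw_def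
          intro!: inv_into_f_eq)
    with * show "(H, G) \<in> Omega_rel n" by (auto simp: Omega_rel_def)
  qed
  show "trans (Omega_rel n)"
  proof (rule transI)
    fix G H K assume "(G, H) \<in> Omega_rel n" "(H, K) \<in> Omega_rel n"
    moreover have "rooted_iso (\<phi>' \<circ> \<phi>) (\<psi>' \<circ> \<psi>) G K"
      if "rooted_iso \<phi> \<psi> G H" "rooted_iso \<phi>' \<psi>' H K" for \<phi> \<psi> \<phi>' \<psi>'
      using that by (auto simp: rooted_iso_def intro: graph_iso_trans)
    ultimately show "(G, K) \<in> Omega_rel n" by (fastforce simp: Omega_rel_def)
  qed
qed (auto simp: Omega_rel_def)

lemma schreier_ends:
  assumes "schreier n G" "e \<in> edges G"
  shows "tail G e \<in> verts G" "head G e \<in> verts G"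
proof -
  have "ends G e = {#tail G e, head G e#}" "set_mset (ends G e) \<subseteq> verts G"
    using assms by (auto simp: schreier_def regular_rooted_graph_def multigraph_def)
  then show "tail G e \<in> verts G" "head G e \<in> verts G" by auto
qed

lemma equiv_Lambda_rel: "equiv {G. schreier n G} (Lambda_rel n)"
proof (rule equivI)
  show "refl_on {G. schreier n G} (Lambda_rel n)"
    using graph_iso_refl
    by (fastforce simp: refl_on_def Lambda_rel_def rooted_iso_def schreier_iso_def)
  show "sym (Lambda_rel n)"
  proof (rule symI)
    fix G H assume "(G, H) \<in> Lambda_rel n"
    then obtain \<phi> \<psi> where *: "schreier n G" "schreier n H" "schreier_iso \<phi> \<psi> G H"
      by (auto simp: Lambda_rel_def)
    let ?\<phi> = "inv_into (verts G) \<phi>" and ?\<psi> = "inv_into (edges G) \<psi>"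
    have mg: "multigraph G" and r: "root_vertex G \<in> verts G"
      using * by (auto simp: schreier_def regular_rooted_graph_def)
    have bij: "bij_betw \<phi> (verts G) (verts H)" "bij_betw \<psi> (edges G) (edges H)"
      using * by (auto simp: graph_iso_def rooted_iso_def schreier_iso_def)
    have "rooted_iso ?\<phi> ?\<psi> H G"
      using graph_iso_sym[of \<phi> \<psi> G H] * mg r bij
      by (auto simp: rooted_iso_def schreier_iso_def bij_betw_def intro!: inv_into_f_eq)
    moreover have "tail G (?\<psi> e) = ?\<phi> (tail H e) \<and> head G (?\<psi> e) = ?\<phi> (head H e) \<and>
        label G (?\<psi> e) = label H e" if e: "e \<in> edges H" for e
    proof -
      have e': "?\<psi> e \<in> edges G" "\<psi> (?\<psi> e) = e"
        using e bij by (auto simp: bij_betw_def inv_into_into f_inv_into_f)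
      have "tail G (?\<psi> e) \<in> verts G" "head G (?\<psi> e) \<in> verts G"
        using schreier_ends[OF *(1) e'(1)] .
      moreover have "tail H e = \<phi> (tail G (?\<psi> e))" "head H e = \<phi> (head G (?\<psi> e))"
        "label H e = label G (?\<psi> e)"
        using *(3) e' unfolding schreier_iso_def by (auto dest!: bspec[OF _ e'(1)])
      ultimately show ?thesis using bij by (simp add: bij_betw_def)
    qed
    ultimately have "schreier_iso ?\<phi> ?\<psi> H G" by (simp add: schreier_iso_def)
    with * show "(H, G) \<in> Lambda_rel n" by (auto simp: Lambda_rel_def)
  qed
  show "trans (Lambda_rel n)"
  proof (rule transI)
    fix G H K assume "(G, H) \<in> Lambda_rel n" "(H, K) \<in> Lambda_rel n"
    moreover have "schreier_iso (\<phi>' \<circ> \<phi>) (\<psi>' \<circ> \<psi>) G K"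
      if "schreier_iso \<phi> \<psi> G H" "schreier_iso \<phi>' \<psi>' H K" for \<phi> \<psi> \<phi>' \<psi>'
    proof -
      have "\<psi> e \<in> edges H" if "e \<in> edges G" for e
        using that \<open>schreier_iso \<phi> \<psi> G H\<close>
        by (auto simp: schreier_iso_def rooted_iso_def graph_iso_def dest: bij_betwE)
      then show ?thesis
        using that graph_iso_trans[of \<phi> \<psi> G H \<phi>' \<psi>' K]
        by (simp add: rooted_iso_def schreier_iso_def)
    qed
    ultimately show "(G, K) \<in> Lambda_rel n" by (fastforce simp: Lambda_rel_def)
  qed
qed (auto simp: Lambda_rel_def)

lemma truncate_simps:
  "verts (rooted_graph.truncate G) = verts G" "edges (rooted_graph.truncate G) = edges G"
  "ends (rooted_graph.truncate G) = ends G"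
  "root_vertex (rooted_graph.truncate G) = root_vertex G"
  by (simp_all add: rooted_graph.truncate_def)

lemma regular_rooted_graph_truncate:
  "regular_rooted_graph d (rooted_graph.truncate G) = regular_rooted_graph d G"
  by (simp add: regular_rooted_graph_def multigraph_def connected_graph_def adjacency_def
      regular_graph_def incident_edges_def truncate_simps)

lemma forget_class:
  assumes "schreier n G"
  shows "forget n (Lambda_rel n `` {G}) = Omega_rel n `` {rooted_graph.truncate G}"
proof -
  have trunc: "(rooted_graph.truncate A, rooted_graph.truncate B) \<in> Omega_rel n"
    if AB: "(A, B) \<in> Lambda_rel n" for A B
  proof -
    obtain \<phi> \<psi> where *: "schreier n A" "schreier n B" "schreier_iso \<phi> \<psi> A B"
      using AB by (auto simp: Lambda_rel_def)
    then have "rooted_iso \<phi> \<psi> (rooted_graph.truncate A) (rooted_graph.truncate B)"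
      by (simp add: schreier_iso_def rooted_iso_def graph_iso_def truncate_simps)
    with * show ?thesis
      by (auto simp: Omega_rel_def regular_rooted_graph_truncate schreier_def)
  qed
  have "Omega_rel n `` {rooted_graph.truncate H} = Omega_rel n `` {rooted_graph.truncate G}"
    if "H \<in> Lambda_rel n `` {G}" for H
    using that trunc[of G H] equiv_class_eq[OF equiv_Omega_rel] by (auto simp: Image_singleton_iff)
  moreover have "G \<in> Lambda_rel n `` {G}"
    using assms equiv_class_self[OF equiv_Lambda_rel] by auto
  ultimately show ?thesis unfolding forget_def by blast
qed

lemma schreier_edge:
  assumes "schreier n G" "v \<in> verts G" "i < n"
  shows "\<exists>!e. e \<in> edges G \<and> tail G e = v \<and> label G e = i"
    and "\<exists>!e. e \<in> edges G \<and> head G e = v \<and> label G e = i"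
  using assms by (auto simp: schreier_def)

lemma regular_rooted_graph_update_root:
  "regular_rooted_graph d G \<Longrightarrow> v \<in> verts G \<Longrightarrow> regular_rooted_graph d (G\<lparr>root_vertex := v\<rparr>)"
  by (simp add: regular_rooted_graph_def multigraph_def connected_graph_def adjacency_def
      regular_graph_def incident_edges_def)

lemma schreier_update_root:
  "schreier n G \<Longrightarrow> v \<in> verts G \<Longrightarrow> schreier n (G\<lparr>root_vertex := v\<rparr>)"
  by (simp add: schreier_def regular_rooted_graph_update_root)

lemma schreier_move_root:
  assumes G: "schreier n G" and l: "fst l < n"
  shows "schreier n (move_root l G)"
proof -
  have r: "root_vertex G \<in> verts G"
    using G by (auto simp: schreier_def regular_rooted_graph_def)
  obtain i b where l': "l = (i, b)" by (cases l)
  then have i: "i < n" using l by simp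
  note edges = theI'[OF schreier_edge(1)[OF G r i]] theI'[OF schreier_edge(2)[OF G r i]]
  have "head G (THE e. e \<in> edges G \<and> tail G e = root_vertex G \<and> label G e = i) \<in> verts G"
    using edges(1) by (intro schreier_ends(2)[OF G]) (rule conjunct1)
  moreover have "tail G (THE e. e \<in> edges G \<and> head G e = root_vertex G \<and> label G e = i) \<in> verts G"
    using edges(2) by (intro schreier_ends(1)[OF G]) (rule conjunct1)
  ultimately show ?thesis
    using schreier_update_root[OF G] by (cases b) (simp_all add: l')
qed

lemma move_root_iso:
  assumes G: "schreier n G" and H: "schreier n H" and iso: "schreier_iso \<phi> \<psi> G H"
    and l: "fst l < n"
  shows "schreier_iso \<phi> \<psi> (move_root l G) (move_root l H)"
proof -
  obtain i b where l': "l = (i, b)" by (cases l)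
  then have i: "i < n" using l by simp
  have rG: "root_vertex G \<in> verts G" and rH: "root_vertex H \<in> verts H"
    using G H by (auto simp: schreier_def regular_rooted_graph_def)
  have r: "root_vertex H = \<phi> (root_vertex G)" and \<psi>: "bij_betw \<psi> (edges G) (edges H)"
    using iso by (auto simp: schreier_iso_def rooted_iso_def graph_iso_def)
  have upd: "schreier_iso \<phi> \<psi> (G\<lparr>root_vertex := v\<rparr>) (H\<lparr>root_vertex := \<phi> v\<rparr>)" for v
    using iso by (simp add: schreier_iso_def rooted_iso_def graph_iso_def)
  have edge: "\<psi> e \<in> edges H \<and> tail H (\<psi> e) = \<phi> (tail G e) \<and> head H (\<psi> e) = \<phi> (head G e) \<and>
      label H (\<psi> e) = label G e" if "e \<in> edges G" for e
    using iso that \<psi> by (auto simp: schreier_iso_def dest: bij_betwE)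
  show ?thesis
  proof (cases b)
    case True
    obtain e where e: "e \<in> edges G" "tail G e = root_vertex G" "label G e = i"
      using schreier_edge(1)[OF G rG i] by blast
    have "(THE e. e \<in> edges G \<and> tail G e = root_vertex G \<and> label G e = i) = e"
      using e by (intro the1_equality schreier_edge(1)[OF G rG i]) auto
    moreover have "(THE e. e \<in> edges H \<and> tail H e = root_vertex H \<and> label H e = i) = \<psi> e"
      using e edge[of e] r by (intro the1_equality schreier_edge(1)[OF H rH i]) auto
    ultimately show ?thesis using upd[of "head G e"] edge[of e] e True l' by simp
  next
    case False
    obtain e where e: "e \<in> edges G" "head G e = root_vertex G" "label G e = i"
      using schreier_edge(2)[OF G rG i] by blast
    have "(THE e. e \<in> edges G \<and> head G e = root_vertex G \<and> label G e = i) = e"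
      using e by (intro the1_equality schreier_edge(2)[OF G rG i]) auto
    moreover have "(THE e. e \<in> edges H \<and> head H e = root_vertex H \<and> label H e = i) = \<psi> e"
      using e edge[of e] r by (intro the1_equality schreier_edge(2)[OF H rH i]) auto
    ultimately show ?thesis using upd[of "tail G e"] edge[of e] e False l' by simp
  qed
qed

lemma move_root_flip:
  assumes G: "schreier n G" and l: "fst l < n"
  shows "move_root l (move_root (flip l) G) = G"
proof -
  obtain i b where l': "l = (i, b)" by (cases l)
  then have i: "i < n" using l by simp
  have r: "root_vertex G \<in> verts G"
    using G by (auto simp: schreier_def regular_rooted_graph_def)
  show ?thesis
  proof (cases b)
    case True
    obtain e where e: "e \<in> edges G" "head G e = root_vertex G" "label G e = i"
      using schreier_edge(2)[OF G r i] by blast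
    have "(THE e. e \<in> edges G \<and> head G e = root_vertex G \<and> label G e = i) = e"
      using e by (intro the1_equality schreier_edge(2)[OF G r i]) auto
    moreover have "(THE e'. e' \<in> edges G \<and> tail G e' = tail G e \<and> label G e' = i) = e"
      using e schreier_ends[OF G] by (intro the1_equality schreier_edge(1)[OF G _ i]) auto
    ultimately show ?thesis using True l' e by simp
  next
    case False
    obtain e where e: "e \<in> edges G" "tail G e = root_vertex G" "label G e = i"
      using schreier_edge(1)[OF G r i] by blast
    have "(THE e. e \<in> edges G \<and> tail G e = root_vertex G \<and> label G e = i) = e"
      using e by (intro the1_equality schreier_edge(1)[OF G r i]) auto
    moreover have "(THE e'. e' \<in> edges G \<and> head G e' = head G e \<and> label G e' = i) = e"
      using e schreier_ends[OF G] by (intro the1_equality schreier_edge(2)[OF G _ i]) auto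
    ultimately show ?thesis using False l' e by simp
  qed
qed

lemma schreier_move_word:
  "schreier n G \<Longrightarrow> set g \<subseteq> {..<n} \<times> UNIV \<Longrightarrow> schreier n (foldr move_root g G)"
proof (induction g)
  case (Cons l g)
  then have "schreier n (foldr move_root g G)" "fst l < n" by auto
  then show ?case using schreier_move_root by simp
qed simp

lemma move_word_iso:
  assumes "schreier n G" "schreier n H" "schreier_iso \<phi> \<psi> G H"
  shows "set g \<subseteq> {..<n} \<times> UNIV \<Longrightarrow> schreier_iso \<phi> \<psi> (foldr move_root g G) (foldr move_root g H)"
proof (induction g)
  case (Cons l g)
  then have g: "set g \<subseteq> {..<n} \<times> UNIV" and l: "fst l < n" by auto
  show ?case
    using move_root_iso[OF schreier_move_word[OF assms(1) g] schreier_move_word[OF assms(2) g]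
        Cons.IH[OF g] l] by simp
qed (use assms in simp)

lemma act_class:
  assumes G: "schreier n G" and g: "g \<in> carrier (free_group n)"
  shows "act n g (Lambda_rel n `` {G}) = Lambda_rel n `` {foldr move_root g G}"
proof -
  have g': "set g \<subseteq> {..<n} \<times> UNIV" using g by (auto simp: free_group_def)
  have "Lambda_rel n `` {foldr move_root g H} = Lambda_rel n `` {foldr move_root g G}"
    if H: "H \<in> Lambda_rel n `` {G}" for H
  proof -
    obtain \<phi> \<psi> where *: "schreier n H" "schreier_iso \<phi> \<psi> G H"
      using H unfolding Lambda_rel_def by blast
    then have "(foldr move_root g G, foldr move_root g H) \<in> Lambda_rel n"
      using schreier_move_word[OF _ g'] move_word_iso[OF G *(1) *(2) g'] G
      by (auto simp: Lambda_rel_def)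
    then show ?thesis using equiv_class_eq[OF equiv_Lambda_rel] by blast
  qed
  moreover have "G \<in> Lambda_rel n `` {G}"
    using G equiv_class_self[OF equiv_Lambda_rel] by auto
  ultimately show ?thesis unfolding act_def by blast
qed

lemma act_in_Lambda:
  assumes "C \<in> Lambda n" "g \<in> carrier (free_group n)"
  shows "act n g C \<in> Lambda n"
proof -
  obtain G where "schreier n G" "C = Lambda_rel n `` {G}"
    using assms by (auto simp: Lambda_def quotient_def)
  then show ?thesis
    using act_class[OF _ assms(2)] schreier_move_word[of n G g] assms(2)
    by (auto simp: Lambda_def free_group_def intro!: quotientI)
qed

lemma act_one:
  assumes "C \<in> Lambda n"
  shows "act n \<one>\<^bsub>free_group n\<^esub> C = C"
proof -
  obtain G where "schreier n G" "C = Lambda_rel n `` {G}"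
    using assms by (auto simp: Lambda_def quotient_def)
  then show ?thesis
    using act_class[of n G "[]"] by (simp add: free_group_def reduced_word_def)
qed

lemma act_mult:
  assumes C: "C \<in> Lambda n" and g: "g \<in> carrier (free_group n)" and h: "h \<in> carrier (free_group n)"
  shows "act n (g \<otimes>\<^bsub>free_group n\<^esub> h) C = act n g (act n h C)"
proof -
  obtain G where G: "schreier n G" "C = Lambda_rel n `` {G}"
    using C by (auto simp: Lambda_def quotient_def)
  have push: "foldr move_root (push l w) G = move_root l (foldr move_root w G)"
    if "set w \<subseteq> {..<n} \<times> UNIV" "fst l < n" for l w
  proof (cases w)
    case (Cons m v)
    then have "schreier n (foldr move_root v G)"
      using that by (intro schreier_move_word[OF G(1)]) auto
    then have "foldr move_root v G = move_root l (move_root (flip l) (foldr move_root v G))"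
      using move_root_flip[of n "foldr move_root v G" l] that by simp
    then show ?thesis by (simp add: Cons del: flip.simps)
  qed simp
  have "set (foldr push u h) \<subseteq> {..<n} \<times> UNIV" if "set u \<subseteq> {..<n} \<times> UNIV" for u
    using that h foldr_push_set[of u h] by (auto simp: free_group_def)
  then have "foldr move_root (foldr push u h) G = foldr move_root u (foldr move_root h G)"
    if "set u \<subseteq> {..<n} \<times> UNIV" for u
    using that by (induction u) (auto simp: push)
  then have "foldr move_root (g \<otimes>\<^bsub>free_group n\<^esub> h) G = foldr move_root g (foldr move_root h G)"
    using g by (auto simp: free_group_def)
  moreover have "g \<otimes>\<^bsub>free_group n\<^esub> h \<in> carrier (free_group n)"
    using group.is_monoid[OF group_free_group] g h by (rule monoid.m_closed)
  moreover have "schreier n (foldr move_root h G)"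
    using schreier_move_word[OF G(1)] h by (auto simp: free_group_def)
  ultimately show ?thesis using G g h by (simp add: act_class)
qed

lemma topspace_Lambda_topology: "topspace (Lambda_topology n) = Lambda n"
proof -
  have "C \<in> \<Union>{cylinder n r U | r U. True}" if C: "C \<in> Lambda n" for C
  proof -
    obtain G where G: "G \<in> C"
      using C in_quotient_imp_non_empty[OF equiv_Lambda_rel] unfolding Lambda_def by blast
    have "schreier_iso id id (neighborhood 0 G) (neighborhood 0 G)"
      by (simp add: schreier_iso_def rooted_iso_def graph_iso_refl)
    then have "C \<in> cylinder n 0 (neighborhood 0 G)" using C G by (auto simp: cylinder_def)
    then show ?thesis by blast
  qed
  then have "\<Union>{cylinder n r U | r U. True} = Lambda n" by (auto simp: cylinder_def)
  then show ?thesis by (simp add: Lambda_topology_def)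
qed

end

theory Submission
  imports Defs
begin

text \<open>
  The heart of the matter is the mass transport principle. Fix vertices \<open>x\<close>, \<open>y\<close> of the
  transitive graph \<open>G\<close>, and let \<open>O\<close> be the orbit of \<open>(x, y)\<close> under the automorphisms of \<open>G\<close> acting
  on pairs of vertices. Being invariant under automorphisms, \<open>O\<close> makes sense in every Schreier
  structure over \<open>G\<close>, without any choice of an identification with \<open>G\<close>. By transitivity, every vertex
  \<open>u\<close> has exactly \<open>|Aut\<^sub>x y|\<close> partners \<open>v\<close> with \<open>(u, v) \<in> O\<close>, and every \<open>v\<close> has exactly
  \<open>|Aut\<^sub>y x|\<close> partners \<open>u\<close> with \<open>(u, v) \<in> O\<close> (\<open>card_orbit_pair\<close>). If every vertex sends unit mass
  to each of its partners, then the root of a random Schreier structure sends mass \<open>|Aut\<^sub>x y|\<close> and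
  receives mass \<open>|Aut\<^sub>y x|\<close>. Under an invariant probability measure the expected masses agree, so
  \<open>G\<close> would be unimodular (\<open>invariant_imp_orbits_balanced\<close>).

  The expected masses are compared as follows. The mass sent by the root is split according to the
  group element \<open>g\<close> that carries it; to count no pair twice, each pair in \<open>O\<close> is assigned to the
  first \<open>g\<close> that leads from one vertex to the other. Translation by \<open>g\<close> turns the mass sent by the
  root along \<open>g\<close> into the mass received by the root along \<open>g\<close>. Since the two vertices of a pair in
  \<open>O\<close> are joined by a path of a fixed length, finitely many \<open>g\<close> are enough
  (\<open>finite_joining_words\<close>) and the sums are finite.

  The events in question have to be Borel sets, and they are in fact closed: by Koenig's lemma, two
  locally finite connected rooted graphs are isomorphic if all their balls are, and this remains true
  when in addition the image of one more vertex is prescribed (\<open>rooted_iso_from_balls\<close>). So if the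
  root and its translate by \<open>g\<close> do not correspond to \<open>x\<close> and \<open>y\<close>, then some ball around the root
  witnesses this (\<open>closed_property_orbit_pair\<close>). The case \<open>g = 1\<close>, \<open>x = y\<close> says that the space of
  Schreier structures over \<open>G\<close> is closed. It is invariant because moving the root of a transitive
  graph yields an isomorphic rooted graph.
\<close>

section \<open>Balls and isomorphisms\<close>

lemma adjacency_verts:
  assumes "multigraph G" "(u, v) \<in> adjacency G"
  shows "u \<in> verts G" "v \<in> verts G"
  using assms by (fastforce simp: adjacency_def multigraph_def)+

lemma adjacency_update_root [simp]: "adjacency (G\<lparr>root_vertex := v\<rparr>) = adjacency G"
  by (simp add: adjacency_def)

lemma multigraph_update_root [simp]: "multigraph (G\<lparr>root_vertex := v\<rparr>) = multigraph G"
  by (simp add: multigraph_def)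

lemma graph_iso_update_root [simp]:
  "graph_iso \<phi> \<psi> (G\<lparr>root_vertex := v\<rparr>) H = graph_iso \<phi> \<psi> G H"
  "graph_iso \<phi> \<psi> G (H\<lparr>root_vertex := w\<rparr>) = graph_iso \<phi> \<psi> G H"
  by (simp_all add: graph_iso_def)

lemma graph_iso_truncate [simp]:
  "graph_iso \<phi> \<psi> (rooted_graph.truncate G) H = graph_iso \<phi> \<psi> G H"
  by (simp add: graph_iso_def truncate_simps)

lemma neighborhood_simps [simp]:
  "verts (neighborhood r G) = ball_vertices r G"
  "edges (neighborhood r G) = {e \<in> edges G. set_mset (ends G e) \<subseteq> ball_vertices r G}"
  "ends (neighborhood r G) = ends G"
  "root_vertex (neighborhood r G) = root_vertex G"
  by (simp_all add: neighborhood_def)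

lemma neighborhood_schreier_simps [simp]:
  "tail (neighborhood r G) = tail G" "head (neighborhood r G) = head G"
  "label (neighborhood r G) = label G"
  by (simp_all add: neighborhood_def)

lemma multigraph_neighborhood: "multigraph G \<Longrightarrow> multigraph (neighborhood r G)"
  by (simp add: multigraph_def)

lemma root_in_ball: "root_vertex G \<in> ball_vertices r G"
  unfolding ball_vertices_def by (auto intro!: exI[of _ 0])

lemma ball_mono: "r \<le> s \<Longrightarrow> ball_vertices r G \<subseteq> ball_vertices s G"
  unfolding ball_vertices_def by (auto intro: order_trans)

lemma ball_step:
  "v \<in> ball_vertices r G \<Longrightarrow> (v, w) \<in> adjacency G \<Longrightarrow> w \<in> ball_vertices (Suc r) G"
  unfolding ball_vertices_def by (fastforce intro: relpow_Suc_I)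

lemma ball_relpow:
  assumes "v \<in> ball_vertices t G" "(v, w) \<in> adjacency G ^^ k"
  shows "w \<in> ball_vertices (t + k) G"
  using assms(2)
proof (induction k arbitrary: w)
  case (Suc k)
  then show ?case using ball_step[of _ "t + k" G w] by auto
qed (use assms(1) in simp)

lemma ball_Suc: "ball_vertices (Suc r) G \<subseteq> ball_vertices r G \<union> adjacency G `` ball_vertices r G"
proof
  fix v assume "v \<in> ball_vertices (Suc r) G"
  then obtain k where k: "k \<le> Suc r" "(root_vertex G, v) \<in> adjacency G ^^ k"
    by (auto simp: ball_vertices_def)
  show "v \<in> ball_vertices r G \<union> adjacency G `` ball_vertices r G"
  proof (cases k)
    case 0
    then show ?thesis using k root_in_ball[of G r] by simp
  next
    case (Suc j)
    then obtain u where "(root_vertex G, u) \<in> adjacency G ^^ j" "(u, v) \<in> adjacency G"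
      using k by auto
    then show ?thesis using k Suc by (auto simp: ball_vertices_def)
  qed
qed

lemma ball_subset_verts:
  assumes "multigraph G" "root_vertex G \<in> verts G"
  shows "ball_vertices r G \<subseteq> verts G"
proof (induction r)
  case 0
  then show ?case using assms by (auto simp: ball_vertices_def)
next
  case (Suc r)
  then show ?case using ball_Suc[of r G] adjacency_verts(2)[OF assms(1)] by blast
qed

lemma ends_pair:
  assumes "multigraph G" "e \<in> edges G"
  shows "\<exists>u\<in>verts G. \<exists>v\<in>verts G. ends G e = {#u, v#}"
proof -
  have "size (ends G e) = Suc (Suc 0)" using assms by (auto simp: multigraph_def)
  then obtain u N where N: "ends G e = add_mset u N" "size N = Suc 0"
    by (metis size_eq_Suc_imp_eq_union size_add_mset nat.inject)
  then obtain v where "N = {#v#}" using size_1_singleton_mset[of N] by auto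
  with N have uv: "ends G e = {#u, v#}" by simp
  then have "u \<in> verts G" "v \<in> verts G" using assms by (auto simp: multigraph_def)
  with uv show ?thesis by blast
qed

lemma finite_adjacent:
  assumes "multigraph G" "regular_graph d G" "u \<in> verts G"
  shows "finite (adjacency G `` {u})"
proof -
  have "adjacency G `` {u} \<subseteq> (\<Union>e\<in>incident_edges G u. set_mset (ends G e))"
    by (fastforce simp: adjacency_def incident_edges_def)
  moreover have "finite (incident_edges G u)" using assms by (auto simp: regular_graph_def)
  ultimately show ?thesis by (rule finite_subset[OF _ finite_UN_I]) auto
qed

lemma finite_ball:
  assumes "regular_rooted_graph d G"
  shows "finite (ball_vertices r G)"
proof (induction r)
  case 0
  have "ball_vertices 0 G = {root_vertex G}" by (auto simp: ball_vertices_def)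
  then show ?case by simp
next
  case (Suc r)
  have "adjacency G `` ball_vertices r G = (\<Union>u\<in>ball_vertices r G. adjacency G `` {u})" by blast
  moreover have "ball_vertices r G \<subseteq> verts G"
    using assms ball_subset_verts by (auto simp: regular_rooted_graph_def)
  ultimately have "finite (adjacency G `` ball_vertices r G)"
    using Suc assms finite_adjacent[of G d] by (auto simp: regular_rooted_graph_def)
  then show ?case using Suc ball_Suc[of r G] by (auto intro: finite_subset)
qed

lemma finite_ball_edges:
  assumes "regular_rooted_graph d G"
  shows "finite (edges (neighborhood r G))"
proof -
  have G: "multigraph G" "root_vertex G \<in> verts G" "regular_graph d G"
    using assms by (auto simp: regular_rooted_graph_def)
  have "edges (neighborhood r G) \<subseteq> (\<Union>u\<in>ball_vertices r G. incident_edges G u)"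
  proof
    fix e assume e: "e \<in> edges (neighborhood r G)"
    then obtain u v where "ends G e = {#u, v#}" using ends_pair[OF G(1), of e] by auto
    with e show "e \<in> (\<Union>u\<in>ball_vertices r G. incident_edges G u)"
      by (auto simp: incident_edges_def)
  qed
  moreover have "finite (\<Union>u\<in>ball_vertices r G. incident_edges G u)"
    using finite_ball[OF assms, of r] ball_subset_verts[OF G(1,2), of r] G(3)
    by (auto simp: regular_graph_def)
  ultimately show ?thesis by (rule finite_subset)
qed

lemma verts_in_ball:
  assumes "regular_rooted_graph d G" "v \<in> verts G"
  shows "\<exists>r. v \<in> ball_vertices r G"
proof -
  have "(root_vertex G, v) \<in> (adjacency G)\<^sup>*"
    using assms by (auto simp: regular_rooted_graph_def connected_graph_def)
  then obtain k where "(root_vertex G, v) \<in> adjacency G ^^ k" using rtrancl_imp_relpow by blast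
  then show ?thesis by (auto simp: ball_vertices_def)
qed

lemma edges_in_ball:
  assumes "regular_rooted_graph d G" "e \<in> edges G"
  shows "\<exists>r. e \<in> edges (neighborhood r G)"
proof -
  have "multigraph G" using assms by (auto simp: regular_rooted_graph_def)
  from ends_pair[OF this assms(2)]
  obtain u v where e: "ends G e = {#u, v#}" "u \<in> verts G" "v \<in> verts G" by blast
  from verts_in_ball[OF assms(1) e(2)] verts_in_ball[OF assms(1) e(3)]
  obtain r s where "u \<in> ball_vertices r G" "v \<in> ball_vertices s G" by blast
  then have "u \<in> ball_vertices (max r s) G" "v \<in> ball_vertices (max r s) G"
    using ball_mono[of r "max r s" G] ball_mono[of s "max r s" G] by auto
  then show ?thesis using e assms(2) by (auto intro!: exI[of _ "max r s"])
qed

lemma verts_UN_ball: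
  assumes "regular_rooted_graph d G"
  shows "verts G = (\<Union>r. ball_vertices r G)"
proof
  show "(\<Union>r. ball_vertices r G) \<subseteq> verts G"
    using assms by (intro UN_least ball_subset_verts) (auto simp: regular_rooted_graph_def)
qed (use verts_in_ball[OF assms] in auto)

lemma edges_UN_ball:
  assumes "regular_rooted_graph d G"
  shows "edges G = (\<Union>r. edges (neighborhood r G))"
proof
  show "edges G \<subseteq> (\<Union>r. edges (neighborhood r G))"
    using edges_in_ball[OF assms] by (intro subsetI) (simp only: UN_iff, blast)
qed auto

lemma neighborhood_mono_edges: "r \<le> s \<Longrightarrow> edges (neighborhood r G) \<subseteq> edges (neighborhood s G)"
  using ball_mono[of r s G] by auto

text \<open>
  A path of length at most \<open>s\<close> that starts within distance \<open>t\<close> of the root stays within distance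
  \<open>t + s\<close>, so a ball around the new root can be computed inside a sufficiently large ball around
  the old root. Both the restriction of isomorphisms to smaller balls (\<open>t = 0\<close>) and the continuity
  of the action (\<open>t\<close> is the length of the word) rest on this.
\<close>

lemma neighborhood_neighborhood:
  assumes v: "v \<in> ball_vertices t G" and r: "t + s \<le> r"
  shows "neighborhood s ((neighborhood r G)\<lparr>root_vertex := v\<rparr>) =
    neighborhood s (G\<lparr>root_vertex := v\<rparr>)"
proof -
  have sub: "adjacency (neighborhood r G) \<subseteq> adjacency G"
    by (auto simp: adjacency_def)
  have relpow_mono_sub: "adjacency (neighborhood r G) ^^ k \<subseteq> adjacency G ^^ k" for k
    by (induction k) (use sub in auto)
  have path: "(v, w) \<in> adjacency (neighborhood r G) ^^ k"
    if "(v, w) \<in> adjacency G ^^ k" "k \<le> s" for k w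
    using that
  proof (induction k arbitrary: w)
    case (Suc k)
    then obtain u where u: "(v, u) \<in> adjacency G ^^ k" "(u, w) \<in> adjacency G" by auto
    have "u \<in> ball_vertices r G" "w \<in> ball_vertices r G"
      using ball_relpow[OF v u(1)] ball_relpow[OF v Suc.prems(1)]
        ball_mono[of "t + k" r G] ball_mono[of "t + Suc k" r G] Suc.prems(2) r by auto
    then have "(u, w) \<in> adjacency (neighborhood r G)"
      using u(2) by (auto simp: adjacency_def)
    then show ?case using Suc u by auto
  qed simp
  have "ball_vertices s ((neighborhood r G)\<lparr>root_vertex := v\<rparr>) =
    ball_vertices s (G\<lparr>root_vertex := v\<rparr>)"
    using path relpow_mono_sub by (fastforce simp: ball_vertices_def)
  moreover have "ball_vertices s (G\<lparr>root_vertex := v\<rparr>) \<subseteq> ball_vertices r G"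
  proof
    fix w assume "w \<in> ball_vertices s (G\<lparr>root_vertex := v\<rparr>)"
    then obtain k where "k \<le> s" "(v, w) \<in> adjacency G ^^ k" by (auto simp: ball_vertices_def)
    then show "w \<in> ball_vertices r G"
      using ball_relpow[OF v] ball_mono[of "t + k" r G] r by auto
  qed
  moreover from this have "{e \<in> edges G. set_mset (ends G e) \<subseteq> ball_vertices r G \<and>
      set_mset (ends G e) \<subseteq> ball_vertices s (G\<lparr>root_vertex := v\<rparr>)} =
      {e \<in> edges G. set_mset (ends G e) \<subseteq> ball_vertices s (G\<lparr>root_vertex := v\<rparr>)}"
    by blast
  ultimately show ?thesis by (simp add: neighborhood_def)
qed

lemma adjacency_iso:
  assumes "graph_iso \<phi> \<psi> G H" "(u, v) \<in> adjacency G"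
  shows "(\<phi> u, \<phi> v) \<in> adjacency H"
proof -
  obtain e where e: "e \<in> edges G" "ends G e = {#u, v#}" using assms by (auto simp: adjacency_def)
  then have "\<psi> e \<in> edges H" "ends H (\<psi> e) = {#\<phi> u, \<phi> v#}"
    using assms by (auto simp: graph_iso_def dest: bij_betwE)
  then show ?thesis by (auto simp: adjacency_def)
qed

lemma relpow_adjacency_iso:
  assumes "graph_iso \<phi> \<psi> G H" "(u, v) \<in> adjacency G ^^ k"
  shows "(\<phi> u, \<phi> v) \<in> adjacency H ^^ k"
  using assms(2)
proof (induction k arbitrary: v)
  case (Suc k)
  then show ?case using adjacency_iso[OF assms(1)] by (auto intro: relpow_Suc_I)
qed simp

lemma rooted_iso_sym:
  assumes "rooted_iso \<phi> \<psi> G H" "multigraph G" "root_vertex G \<in> verts G"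
  shows "rooted_iso (inv_into (verts G) \<phi>) (inv_into (edges G) \<psi>) H G"
  using assms graph_iso_sym[of \<phi> \<psi> G H]
  by (auto simp: rooted_iso_def graph_iso_def bij_betw_def intro!: inv_into_f_eq)

lemma rooted_iso_trans:
  "rooted_iso \<phi> \<psi> G H \<Longrightarrow> rooted_iso \<phi>' \<psi>' H K \<Longrightarrow> rooted_iso (\<phi>' \<circ> \<phi>) (\<psi>' \<circ> \<psi>) G K"
  by (auto simp: rooted_iso_def intro: graph_iso_trans)

lemma schreier_iso_trans:
  assumes "schreier_iso \<phi> \<psi> G H" "schreier_iso \<phi>' \<psi>' H K"
  shows "schreier_iso (\<phi>' \<circ> \<phi>) (\<psi>' \<circ> \<psi>) G K"
proof -
  have "\<psi> e \<in> edges H" if "e \<in> edges G" for e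
    using that assms(1) by (auto simp: schreier_iso_def rooted_iso_def graph_iso_def dest: bij_betwE)
  then show ?thesis
    using assms rooted_iso_trans[of \<phi> \<psi> G H \<phi>' \<psi>' K] by (simp add: schreier_iso_def)
qed

lemma ball_image:
  assumes iso: "rooted_iso \<phi> \<psi> G H" and G: "multigraph G" "root_vertex G \<in> verts G"
    and H: "multigraph H"
  shows "\<phi> ` ball_vertices r G = ball_vertices r H"
proof
  show "\<phi> ` ball_vertices r G \<subseteq> ball_vertices r H"
    using iso relpow_adjacency_iso[of \<phi> \<psi> G H]
    by (fastforce simp: ball_vertices_def rooted_iso_def)
  let ?\<phi> = "inv_into (verts G) \<phi>"
  have inv: "rooted_iso ?\<phi> (inv_into (edges G) \<psi>) H G" by (rule rooted_iso_sym[OF iso G])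
  have bij: "bij_betw \<phi> (verts G) (verts H)"
    and r: "root_vertex H = \<phi> (root_vertex G)"
    using iso by (auto simp: rooted_iso_def graph_iso_def)
  have "root_vertex H \<in> verts H" using r bij G(2) by (auto dest: bij_betwE)
  show "ball_vertices r H \<subseteq> \<phi> ` ball_vertices r G"
  proof
    fix w assume w: "w \<in> ball_vertices r H"
    then have "?\<phi> w \<in> ball_vertices r G"
      using inv relpow_adjacency_iso[of ?\<phi> _ H G]
      by (fastforce simp: ball_vertices_def rooted_iso_def)
    moreover have "w \<in> verts H"
      using w ball_subset_verts[OF H \<open>root_vertex H \<in> verts H\<close>] by auto
    then have "\<phi> (?\<phi> w) = w" using bij by (auto simp: bij_betw_def f_inv_into_f)
    ultimately show "w \<in> \<phi> ` ball_vertices r G" by force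
  qed
qed

lemma rooted_iso_neighborhood:
  assumes iso: "rooted_iso \<phi> \<psi> G H" and G: "multigraph G" "root_vertex G \<in> verts G"
    and H: "multigraph H"
  shows "rooted_iso \<phi> \<psi> (neighborhood r G) (neighborhood r H)"
proof -
  have bij: "bij_betw \<phi> (verts G) (verts H)" "bij_betw \<psi> (edges G) (edges H)"
    and ends: "\<And>e. e \<in> edges G \<Longrightarrow> ends H (\<psi> e) = image_mset \<phi> (ends G e)"
    using iso by (auto simp: rooted_iso_def graph_iso_def)
  note ball = ball_image[OF assms, of r]
  note sub = ball_subset_verts[OF G, of r]
  have inside: "set_mset (ends H (\<psi> e)) \<subseteq> ball_vertices r H \<longleftrightarrow> set_mset (ends G e) \<subseteq> ball_vertices r G"
    if e: "e \<in> edges G" for e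
  proof -
    have "set_mset (ends G e) \<subseteq> verts G" using e G(1) by (auto simp: multigraph_def)
    then have "\<phi> ` set_mset (ends G e) \<subseteq> \<phi> ` ball_vertices r G
        \<longleftrightarrow> set_mset (ends G e) \<subseteq> ball_vertices r G"
      using inj_on_image_subset_iff[of \<phi> "verts G"] bij(1) sub by (auto simp: bij_betw_def)
    then show ?thesis using e ball by (simp add: ends)
  qed
  have "\<psi> ` edges (neighborhood r G) = edges (neighborhood r H)"
  proof
    show "\<psi> ` edges (neighborhood r G) \<subseteq> edges (neighborhood r H)"
      using inside bij(2) by (auto dest: bij_betwE)
    show "edges (neighborhood r H) \<subseteq> \<psi> ` edges (neighborhood r G)"
    proof
      fix e assume e: "e \<in> edges (neighborhood r H)"
      then obtain e' where "e' \<in> edges G" "e = \<psi> e'" using bij(2) by (auto simp: bij_betw_def)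
      then show "e \<in> \<psi> ` edges (neighborhood r G)" using e inside by auto
    qed
  qed
  moreover have "inj_on \<psi> (edges (neighborhood r G))" "inj_on \<phi> (ball_vertices r G)"
    using bij sub by (auto simp: bij_betw_def intro: inj_on_subset)
  ultimately show ?thesis
    using iso ball ends by (auto simp: rooted_iso_def graph_iso_def bij_betw_def)
qed

lemma schreier_iso_neighborhood:
  assumes "schreier_iso \<phi> \<psi> G H" "multigraph G" "root_vertex G \<in> verts G" "multigraph H"
  shows "schreier_iso \<phi> \<psi> (neighborhood r G) (neighborhood r H)"
  using assms rooted_iso_neighborhood[of \<phi> \<psi> G H r] by (auto simp: schreier_iso_def)

section \<open>Isomorphism of all balls implies isomorphism\<close>

text \<open>
  Koenig's lemma: the values at \<open>0, 1, 2, \<dots>\<close> are fixed one after the other, and each time the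
  pigeonhole principle leaves infinitely many of the functions that have the values fixed so far.
\<close>

lemma pointwise_limit_function:
  fixes f :: "nat \<Rightarrow> nat \<Rightarrow> 'a"
  assumes "\<And>k. finite (range (\<lambda>r. f r k))"
  obtains g where "\<And>k. infinite {r. \<forall>i<k. f r i = g i}"
proof -
  have "\<exists>R. \<forall>k. infinite (R k) \<and> (R (Suc k) \<subseteq> R k \<and> (\<exists>c. \<forall>r\<in>R (Suc k). f r k = c))"
  proof (rule dependent_nat_choice)
    show "\<exists>R::nat set. infinite R" by blast
    fix R :: "nat set" and k assume R: "infinite R"
    have "finite ((\<lambda>r. f r k) ` R)" using assms[of k] by (rule finite_subset[rotated]) auto
    then obtain r where "infinite {s \<in> R. f s k = f r k}" using pigeonhole_infinite[OF R] by blast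
    then show "\<exists>S. infinite S \<and> (S \<subseteq> R \<and> (\<exists>c. \<forall>r\<in>S. f r k = c))"
      by (intro exI[of _ "{s \<in> R. f s k = f r k}"]) auto
  qed
  then obtain R where R: "\<And>k. infinite (R k)" "\<And>k. R (Suc k) \<subseteq> R k"
    "\<And>k. \<exists>c. \<forall>r\<in>R (Suc k). f r k = c" by blast
  obtain g where g: "\<And>k r. r \<in> R (Suc k) \<Longrightarrow> f r k = g k" using R(3) by metis
  have "R k \<subseteq> R (Suc i)" if "i < k" for i k
    using lift_Suc_antimono_le[of R "Suc i" k] R(2) that by simp
  then have "R k \<subseteq> {r. \<forall>i<k. f r i = g i}" for k using g by blast
  then have "infinite {r. \<forall>i<k. f r i = g i}" for k using R(1) infinite_super by blast
  then show ?thesis using that by blast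
qed

lemma finite_range_eventually:
  fixes f :: "nat \<Rightarrow> 'a"
  assumes "\<And>r. r \<ge> m \<Longrightarrow> f r \<in> A" "finite A"
  shows "finite (range f)"
proof (rule finite_subset)
  show "range f \<subseteq> A \<union> f ` {..<m}" using assms(1) by (auto simp: not_less[symmetric])
qed (use assms(2) in auto)

text \<open>
  Two functions are needed, on vertices and on edges, so they are paired up. Outside the graph they
  are replaced by a constant, because there an isomorphism of balls may take any value. The limit
  is surjective because an isomorphism maps each ball onto the ball with the same radius, and balls
  are finite. The extra condition \<open>\<phi> v = w\<close> passes to the limit.
\<close>

lemma rooted_iso_from_balls:
  fixes G :: "(nat, nat, 'y) rooted_graph_scheme" and H :: "('w, 'f, 'z) rooted_graph_scheme"
  assumes G: "regular_rooted_graph d G" and H: "regular_rooted_graph d' H"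
    and v: "v \<in> verts G"
    and balls: "\<And>r. r \<ge> r0 \<Longrightarrow>
      \<exists>\<phi> \<psi>. rooted_iso \<phi> \<psi> (neighborhood r G) (neighborhood r H) \<and> \<phi> v = w"
  obtains \<phi> \<psi> where "rooted_iso \<phi> \<psi> G H" "\<phi> v = w"
proof -
  have mG: "multigraph G" and rG: "root_vertex G \<in> verts G"
    and mH: "multigraph H" and rH: "root_vertex H \<in> verts H"
    using G H by (auto simp: regular_rooted_graph_def)
  obtain \<Phi> \<Psi> where iso: "\<And>r. r \<ge> r0 \<Longrightarrow> rooted_iso (\<Phi> r) (\<Psi> r) (neighborhood r G) (neighborhood r H)"
    and mark: "\<And>r. r \<ge> r0 \<Longrightarrow> \<Phi> r v = w"
    using balls by metis
  \<comment> \<open>an isomorphism of balls restricts to the smaller balls\<close>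
  have iso_le: "rooted_iso (\<Phi> r) (\<Psi> r) (neighborhood k G) (neighborhood k H)"
    if "r \<ge> r0" "k \<le> r" for r k
  proof -
    have "neighborhood k (neighborhood r G) = neighborhood k G"
      "neighborhood k (neighborhood r H) = neighborhood k H"
      using neighborhood_neighborhood[OF root_in_ball, of 0 k r G]
        neighborhood_neighborhood[OF root_in_ball, of 0 k r H] that
      by (simp_all add: neighborhood_def ball_vertices_def adjacency_def)
    then show ?thesis
      using rooted_iso_neighborhood[OF iso[OF that(1)], of k] mG mH
      by (simp add: multigraph_neighborhood root_in_ball)
  qed
  have \<Phi>_img: "\<Phi> r ` ball_vertices k G = ball_vertices k H"
    and \<Psi>_img: "\<Psi> r ` edges (neighborhood k G) = edges (neighborhood k H)"
    and \<Phi>_inj: "inj_on (\<Phi> r) (ball_vertices k G)"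
    and \<Psi>_inj: "inj_on (\<Psi> r) (edges (neighborhood k G))"
    and ends: "\<And>e. e \<in> edges (neighborhood k G) \<Longrightarrow> ends H (\<Psi> r e) = image_mset (\<Phi> r) (ends G e)"
    if "r \<ge> r0" "k \<le> r" for r k
    using iso_le[OF that] by (auto simp: rooted_iso_def graph_iso_def bij_betw_def)

  define f where "f r k = (if k \<in> verts G then \<Phi> r k else undefined,
    if k \<in> edges G then \<Psi> r k else undefined)" for r k
  have "finite (range (\<lambda>r. f r k))" for k
  proof -
    have fin1: "finite (range (\<lambda>r. fst (f r k)))"
    proof (cases "k \<in> verts G")
      case True
      then obtain s where s: "k \<in> ball_vertices s G" using verts_in_ball[OF G] by blast
      have "fst (f r k) \<in> ball_vertices s H" if "r \<ge> max r0 s" for r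
        using \<Phi>_img[of r s] that s True by (auto simp: f_def)
      then show ?thesis by (rule finite_range_eventually[OF _ finite_ball[OF H]])
    qed (simp add: f_def)
    have fin2: "finite (range (\<lambda>r. snd (f r k)))"
    proof (cases "k \<in> edges G")
      case True
      then obtain s where s: "k \<in> edges (neighborhood s G)" using edges_in_ball[OF G] by blast
      have "snd (f r k) \<in> edges (neighborhood s H)" if "r \<ge> max r0 s" for r
        using \<Psi>_img[of r s] that s True by (force simp: f_def simp del: neighborhood_simps)
      then show ?thesis by (rule finite_range_eventually[OF _ finite_ball_edges[OF H]])
    qed (simp add: f_def)
    have sub: "range (\<lambda>r. f r k) \<subseteq> range (\<lambda>r. fst (f r k)) \<times> range (\<lambda>r. snd (f r k))"
      by (intro image_subsetI) (simp add: mem_Times_iff)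
    show ?thesis by (rule finite_subset[OF sub finite_cartesian_product[OF fin1 fin2]])
  qed
  then obtain g where g: "\<And>k. infinite {r. \<forall>i<k. f r i = g i}" using pointwise_limit_function by blast
  define \<phi> where "\<phi> = fst \<circ> g"
  define \<psi> where "\<psi> = snd \<circ> g"
  have agree: "\<exists>r\<ge>max r0 m. (\<forall>u\<in>V. \<Phi> r u = \<phi> u) \<and> (\<forall>e\<in>E. \<Psi> r e = \<psi> e)"
    if VE: "finite V" "V \<subseteq> verts G" "finite E" "E \<subseteq> edges G" for V E m
  proof -
    obtain k where k: "\<And>i. i \<in> V \<union> E \<Longrightarrow> i < k"
      using VE finite_nat_set_iff_bounded[of "V \<union> E"] by blast
    have "\<exists>r\<ge>max r0 m. \<forall>i<k. f r i = g i"
      using g[of k] unfolding infinite_nat_iff_unbounded_le by blast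
    then obtain r where r: "r \<ge> max r0 m" "\<And>i. i < k \<Longrightarrow> f r i = g i" by blast
    have "\<Phi> r u = \<phi> u" if "u \<in> V" for u
      using r(2)[symmetric, of u] k[of u] that \<open>V \<subseteq> verts G\<close> by (auto simp: \<phi>_def f_def)
    moreover have "\<Psi> r e = \<psi> e" if "e \<in> E" for e
      using r(2)[symmetric, of e] k[of e] that \<open>E \<subseteq> edges G\<close> by (auto simp: \<psi>_def f_def)
    ultimately show ?thesis using r(1) by blast
  qed
  have ball_agree: "\<exists>r\<ge>max r0 k. (\<forall>u\<in>ball_vertices k G. \<Phi> r u = \<phi> u) \<and>
      (\<forall>e\<in>edges (neighborhood k G). \<Psi> r e = \<psi> e)" for k
    using agree[of "ball_vertices k G" "edges (neighborhood k G)" k] finite_ball[OF G]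
      finite_ball_edges[OF G] ball_subset_verts[OF mG rG] by auto
  have level: "rooted_iso \<phi> \<psi> (neighborhood k G) (neighborhood k H)" for k
  proof -
    obtain r where r: "r \<ge> max r0 k" "\<And>u. u \<in> ball_vertices k G \<Longrightarrow> \<Phi> r u = \<phi> u"
      "\<And>e. e \<in> edges (neighborhood k G) \<Longrightarrow> \<Psi> r e = \<psi> e" using ball_agree[of k] by blast
    have "bij_betw \<phi> (ball_vertices k G) (ball_vertices k H)"
      using bij_betw_cong[of "ball_vertices k G" "\<Phi> r" \<phi>] r \<Phi>_img[of r k] \<Phi>_inj[of r k]
      by (auto simp: bij_betw_def)
    moreover have "bij_betw \<psi> (edges (neighborhood k G)) (edges (neighborhood k H))"
      using bij_betw_cong[of "edges (neighborhood k G)" "\<Psi> r" \<psi>] r \<Psi>_img[of r k] \<Psi>_inj[of r k]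
      by (auto simp: bij_betw_def simp del: neighborhood_simps)
    moreover have "ends H (\<psi> e) = image_mset \<phi> (ends G e)" if e: "e \<in> edges (neighborhood k G)" for e
    proof -
      have "image_mset (\<Phi> r) (ends G e) = image_mset \<phi> (ends G e)"
        using e r(2) by (intro image_mset_cong) auto
      then show ?thesis using ends[of r k e] e r by (simp del: neighborhood_simps)
    qed
    moreover have "\<phi> (root_vertex G) = root_vertex H"
      using iso[of r] r(1) r(2)[OF root_in_ball] by (simp add: rooted_iso_def)
    ultimately show ?thesis by (simp add: rooted_iso_def graph_iso_def)
  qed
  have "bij_betw \<phi> (\<Union>k. ball_vertices k G) (\<Union>k. ball_vertices k H)"
  proof (rule bij_betw_UNION_chain)
    show "ball_vertices i G \<subseteq> ball_vertices j G \<or> ball_vertices j G \<subseteq> ball_vertices i G" for i j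
      using ball_mono[of i j G] ball_mono[of j i G] linear by blast
    show "bij_betw \<phi> (ball_vertices i G) (ball_vertices i H)" for i
      using level[of i] by (auto simp: rooted_iso_def graph_iso_def)
  qed
  then have "bij_betw \<phi> (verts G) (verts H)" using verts_UN_ball[OF G] verts_UN_ball[OF H] by simp
  moreover have "bij_betw \<psi> (\<Union>k. edges (neighborhood k G)) (\<Union>k. edges (neighborhood k H))"
  proof (rule bij_betw_UNION_chain)
    show "edges (neighborhood i G) \<subseteq> edges (neighborhood j G) \<or>
        edges (neighborhood j G) \<subseteq> edges (neighborhood i G)" for i j
      using neighborhood_mono_edges[of i j G] neighborhood_mono_edges[of j i G] linear by blast
    show "bij_betw \<psi> (edges (neighborhood i G)) (edges (neighborhood i H))" for i
      using level[of i] unfolding rooted_iso_def graph_iso_def by blast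
  qed
  then have "bij_betw \<psi> (edges G) (edges H)"
    by (simp only: edges_UN_ball[OF G] edges_UN_ball[OF H])
  moreover have "ends H (\<psi> e) = image_mset \<phi> (ends G e)" if "e \<in> edges G" for e
    using edges_in_ball[OF G that] level unfolding rooted_iso_def graph_iso_def neighborhood_simps(3)
    by blast
  moreover have "\<phi> (root_vertex G) = root_vertex H" using level by (simp add: rooted_iso_def)
  moreover have "\<phi> v = w" using agree[of "{v}" "{}" 0] v mark by auto
  ultimately show ?thesis
    by (intro that[of \<phi> \<psi>]) (simp_all add: rooted_iso_def graph_iso_def)
qed

section \<open>Walks in a Schreier graph\<close>

text \<open>
  The action moves only the root, so it is convenient to let words act on the vertices of a fixed
  Schreier graph. As in \<^const>\<open>act\<close>, the last letter of a word is followed first.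
\<close>

definition step :: "('v, 'e) schreier_graph \<Rightarrow> letter \<Rightarrow> 'v \<Rightarrow> 'v" where
  "step H l v = root_vertex (move_root l (H\<lparr>root_vertex := v\<rparr>))"

definition walk :: "('v, 'e) schreier_graph \<Rightarrow> letter list \<Rightarrow> 'v \<Rightarrow> 'v" where
  "walk H w v = foldr (step H) w v"

lemma walk_simps [simp]:
  "walk H [] v = v" "walk H (l # w) v = step H l (walk H w v)"
  "walk H (w @ w') v = walk H w (walk H w' v)"
  by (simp_all add: walk_def)

lemma step_update_root [simp]: "step (H\<lparr>root_vertex := v\<rparr>) = step H"
  by (intro ext) (simp add: step_def)

lemma walk_update_root [simp]: "walk (H\<lparr>root_vertex := v\<rparr>) = walk H"
  by (intro ext) (simp add: walk_def)

lemma move_root_eq: "move_root l H = H\<lparr>root_vertex := step H l (root_vertex H)\<rparr>"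
proof -
  obtain i b where "l = (i, b)" by (cases l)
  then show ?thesis by (cases b) (simp_all add: step_def)
qed

lemma foldr_move_root: "foldr move_root w H = H\<lparr>root_vertex := walk H w (root_vertex H)\<rparr>"
  by (induction w) (simp_all add: move_root_eq)

lemma schreier_multigraph: "schreier n H \<Longrightarrow> multigraph H"
  and schreier_root: "schreier n H \<Longrightarrow> root_vertex H \<in> verts H"
  by (auto simp: schreier_def regular_rooted_graph_def)

lemma step_edge:
  assumes H: "schreier n H" and e: "e \<in> edges H"
  shows "step H (label H e, True) (tail H e) = head H e"
    and "step H (label H e, False) (head H e) = tail H e"
proof -
  have i: "label H e < n" using assms by (auto simp: schreier_def)
  note v = schreier_ends[OF H e]
  have "(THE e'. e' \<in> edges H \<and> tail H e' = tail H e \<and> label H e' = label H e) = e"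
    using e by (intro the1_equality schreier_edge(1)[OF H v(1) i]) auto
  then show "step H (label H e, True) (tail H e) = head H e" by (simp add: step_def)
  have "(THE e'. e' \<in> edges H \<and> head H e' = head H e \<and> label H e' = label H e) = e"
    using e by (intro the1_equality schreier_edge(2)[OF H v(2) i]) auto
  then show "step H (label H e, False) (head H e) = tail H e" by (simp add: step_def)
qed

lemma edge_of_step:
  assumes H: "schreier n H" and v: "v \<in> verts H" and l: "l \<in> {..<n} \<times> UNIV"
  shows "\<exists>e\<in>edges H. (l = (label H e, True) \<and> v = tail H e \<and> step H l v = head H e) \<or>
    (l = (label H e, False) \<and> v = head H e \<and> step H l v = tail H e)"
proof -
  obtain i b where l': "l = (i, b)" "i < n" using l by auto
  show ?thesis
  proof (cases b)
    case True
    obtain e where "e \<in> edges H" "tail H e = v" "label H e = i"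
      using schreier_edge(1)[OF H v l'(2)] by blast
    then show ?thesis using step_edge[OF H] True l' by auto
  next
    case False
    obtain e where "e \<in> edges H" "head H e = v" "label H e = i"
      using schreier_edge(2)[OF H v l'(2)] by blast
    then show ?thesis using step_edge[OF H] False l' by auto
  qed
qed

lemma step_in_verts:
  assumes "schreier n H" "v \<in> verts H" "l \<in> {..<n} \<times> UNIV"
  shows "step H l v \<in> verts H"
  using edge_of_step[OF assms] schreier_ends[OF assms(1)] by auto

lemma step_adjacent:
  assumes "schreier n H" "v \<in> verts H" "l \<in> {..<n} \<times> UNIV"
  shows "(v, step H l v) \<in> adjacency H"
proof -
  have "ends H e = {#tail H e, head H e#}" if "e \<in> edges H" for e
    using assms(1) that by (auto simp: schreier_def)
  then show ?thesis using edge_of_step[OF assms] by (fastforce simp: adjacency_def add_mset_commute)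
qed

lemma step_flip:
  assumes "schreier n H" "v \<in> verts H" "l \<in> {..<n} \<times> UNIV"
  shows "step H (flip l) (step H l v) = v"
  using edge_of_step[OF assms] step_edge[OF assms(1)] by auto

lemma walk_in_verts:
  assumes "schreier n H" "v \<in> verts H" "set w \<subseteq> {..<n} \<times> UNIV"
  shows "walk H w v \<in> verts H"
  using assms(3) by (induction w) (auto intro!: assms(2) step_in_verts[OF assms(1)])

lemma walk_relpow:
  assumes "schreier n H" "v \<in> verts H" "set w \<subseteq> {..<n} \<times> UNIV"
  shows "(v, walk H w v) \<in> adjacency H ^^ length w"
  using assms(3)
proof (induction w)
  case (Cons l w)
  then show ?case
    using step_adjacent[OF assms(1) walk_in_verts[OF assms(1,2), of w], of l]
    by (auto intro: relpow_Suc_I)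
qed simp

lemma walk_in_ball:
  assumes "schreier n H" "set w \<subseteq> {..<n} \<times> UNIV"
  shows "walk H w (root_vertex H) \<in> ball_vertices (length w) H"
  using walk_relpow[OF assms(1) schreier_root[OF assms(1)] assms(2)]
  by (auto simp: ball_vertices_def)

lemma walk_inverse:
  assumes H: "schreier n H" and v: "v \<in> verts H" and g: "set g \<subseteq> {..<n} \<times> UNIV"
  shows "walk H (rev (map flip g)) (walk H g v) = v"
  using g
proof (induction g)
  case (Cons l g)
  then show ?case using step_flip[OF H walk_in_verts[OF H v, of g], of l] by auto
qed simp

lemma walk_push:
  assumes H: "schreier n H" and v: "v \<in> verts H" and lw: "set (l # w) \<subseteq> {..<n} \<times> UNIV"
  shows "walk H (push l w) v = step H l (walk H w v)"
proof (cases w)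
  case (Cons m w')
  then have "fst m < n" "set w' \<subseteq> {..<n} \<times> UNIV" using lw by auto
  then show ?thesis
    using Cons step_flip[OF H walk_in_verts[OF H v, of w'], of m]
    by (cases l) (auto simp: mem_Times_iff)
qed simp

lemma walk_reduce:
  assumes H: "schreier n H" and v: "v \<in> verts H" and w: "set w \<subseteq> {..<n} \<times> UNIV"
  shows "walk H (foldr push w []) v = walk H w v"
  using w
proof (induction w)
  case (Cons l w)
  have "set (foldr push w []) \<subseteq> {..<n} \<times> UNIV"
    using foldr_push_set[of w "[]"] Cons.prems by auto
  then show ?case using walk_push[OF H v, of l "foldr push w []"] Cons by auto
qed simp

lemma walk_exists:
  assumes H: "schreier n H" and uv: "(u, v) \<in> adjacency H ^^ k"
  shows "\<exists>w. set w \<subseteq> {..<n} \<times> UNIV \<and> length w = k \<and> walk H w u = v"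
  using uv
proof (induction k arbitrary: v)
  case (Suc k)
  then obtain t where t: "(u, t) \<in> adjacency H ^^ k" "(t, v) \<in> adjacency H" by auto
  then obtain w where w: "set w \<subseteq> {..<n} \<times> UNIV" "length w = k" "walk H w u = t"
    using Suc.IH by blast
  obtain e where e: "e \<in> edges H" "ends H e = {#t, v#}" using t(2) by (auto simp: adjacency_def)
  then have "{#tail H e, head H e#} = {#t, v#}" and i: "label H e < n"
    using H by (auto simp: schreier_def)
  then consider "tail H e = t" "head H e = v" | "tail H e = v" "head H e = t"
    by (auto simp: add_eq_conv_ex)
  then show ?case
  proof cases
    case 1
    then show ?thesis using step_edge(1)[OF H e(1)] w i
      by (intro exI[of _ "(label H e, True) # w"]) auto
  next
    case 2
    then show ?thesis using step_edge(2)[OF H e(1)] w i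
      by (intro exI[of _ "(label H e, False) # w"]) auto
  qed
qed simp

text \<open>
  The edges that a word of length at most \<open>r\<close> follows from the root have both ends in the
  \<open>r\<close>-ball, so the ball determines where the walk leads.
\<close>

lemma walk_neighborhood_iso:
  assumes H: "schreier n H" and H': "schreier n H'"
    and iso: "schreier_iso \<phi> \<psi> (neighborhood r H) (neighborhood r H')"
    and w: "set w \<subseteq> {..<n} \<times> UNIV" "length w \<le> r"
  shows "\<phi> (walk H w (root_vertex H)) = walk H' w (root_vertex H')"
  using w
proof (induction w)
  case Nil
  then show ?case using iso by (simp add: schreier_iso_def rooted_iso_def)
next
  case (Cons l w)
  let ?v = "walk H w (root_vertex H)"
  have w: "set w \<subseteq> {..<n} \<times> UNIV" and l: "l \<in> {..<n} \<times> UNIV" using Cons.prems by auto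
  have in_ball: "?v \<in> ball_vertices r H" "step H l ?v \<in> ball_vertices r H"
    using walk_in_ball[OF H w] walk_in_ball[OF H Cons.prems(1)] Cons.prems(2)
      ball_mono[of "length w" r H] ball_mono[of "Suc (length w)" r H] by auto
  obtain e where e: "e \<in> edges H"
    "(l = (label H e, True) \<and> ?v = tail H e \<and> step H l ?v = head H e) \<or>
     (l = (label H e, False) \<and> ?v = head H e \<and> step H l ?v = tail H e)"
    using edge_of_step[OF H walk_in_verts[OF H schreier_root[OF H] w] l] by blast
  have "ends H e = {#tail H e, head H e#}" using H e(1) by (auto simp: schreier_def)
  then have eN: "e \<in> edges (neighborhood r H)" using e in_ball by auto
  then have "\<psi> e \<in> edges H'" "tail H' (\<psi> e) = \<phi> (tail H e)" "head H' (\<psi> e) = \<phi> (head H e)"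
    "label H' (\<psi> e) = label H e"
    using iso by (auto simp: schreier_iso_def rooted_iso_def graph_iso_def dest: bij_betwE)
  moreover have "\<phi> ?v = walk H' w (root_vertex H')" using Cons w by auto
  ultimately show ?case using e(2) step_edge[OF H', of "\<psi> e"] by auto
qed

section \<open>Topology and continuity of the action\<close>

abbreviation schreier_class :: "nat \<Rightarrow> (nat, nat) schreier_graph \<Rightarrow> (nat, nat) schreier_graph set" where
  "schreier_class n H \<equiv> Lambda_rel n `` {H}"

lemma Lambda_cases:
  assumes "C \<in> Lambda n"
  obtains H where "schreier n H" "C = schreier_class n H"
  using assms by (auto simp: Lambda_def quotient_def)

lemma schreier_class_in_Lambda: "schreier n H \<Longrightarrow> schreier_class n H \<in> Lambda n"
  by (auto simp: Lambda_def intro!: quotientI)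

lemma in_own_schreier_class: "schreier n H \<Longrightarrow> H \<in> schreier_class n H"
  using equiv_class_self[OF equiv_Lambda_rel] by auto

lemma Lambda_member:
  assumes "C \<in> Lambda n" "H \<in> C"
  shows "schreier n H" "C = schreier_class n H"
proof -
  obtain K where K: "schreier n K" "C = schreier_class n K" using assms(1) by (rule Lambda_cases)
  then have KH: "(K, H) \<in> Lambda_rel n" using assms(2) by auto
  then show "schreier n H" by (auto simp: Lambda_rel_def)
  show "C = schreier_class n H" using equiv_class_eq[OF equiv_Lambda_rel KH] K(2) by simp
qed

lemma schreier_iso_ball:
  assumes "schreier n G" "schreier n H" "schreier_iso \<phi> \<psi> G H"
  shows "schreier_iso \<phi> \<psi> (neighborhood r G) (neighborhood r H)"
  using assms(3) schreier_multigraph[OF assms(1)] schreier_root[OF assms(1)]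
    schreier_multigraph[OF assms(2)] by (rule schreier_iso_neighborhood)

lemma openin_LambdaI:
  assumes "U \<subseteq> Lambda n"
    and local: "\<And>H. schreier n H \<Longrightarrow> schreier_class n H \<in> U \<Longrightarrow>
      \<exists>r. \<forall>H' \<phi> \<psi>. schreier n H' \<longrightarrow> schreier_iso \<phi> \<psi> (neighborhood r H') (neighborhood r H) \<longrightarrow>
        schreier_class n H' \<in> U"
  shows "openin (Lambda_topology n) U"
proof (subst openin_subopen, intro ballI)
  fix C assume C: "C \<in> U"
  then have "C \<in> Lambda n" using assms(1) by auto
  then obtain H where H: "schreier n H" "C = schreier_class n H" by (rule Lambda_cases)
  then obtain r where r: "\<And>H' \<phi> \<psi>. schreier n H' \<Longrightarrow>
      schreier_iso \<phi> \<psi> (neighborhood r H') (neighborhood r H) \<Longrightarrow> schreier_class n H' \<in> U"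
    using local[OF H(1)] C by blast
  let ?T = "cylinder n r (neighborhood r H)"
  have "openin (Lambda_topology n) ?T"
    unfolding Lambda_topology_def by (rule topology_generated_by_Basis) blast
  moreover have "schreier_iso id id (neighborhood r H) (neighborhood r H)"
    by (simp add: schreier_iso_def rooted_iso_def graph_iso_refl)
  then have "C \<in> ?T"
    using \<open>C \<in> Lambda n\<close> in_own_schreier_class[OF H(1)] H(2) unfolding cylinder_def by blast
  moreover have "?T \<subseteq> U"
  proof
    fix D assume "D \<in> ?T"
    then obtain H' \<phi> \<psi> where H': "D \<in> Lambda n" "H' \<in> D"
      "schreier_iso \<phi> \<psi> (neighborhood r H') (neighborhood r H)"
      unfolding cylinder_def by blast
    then show "D \<in> U" using Lambda_member[OF H'(1,2)] r by blast
  qed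
  ultimately show "\<exists>T. openin (Lambda_topology n) T \<and> C \<in> T \<and> T \<subseteq> U" by blast
qed

text \<open>
  The closed subsets of the space of Schreier graphs are given by the properties that fail only if
  some ball around the root excludes them. Such a property is automatically invariant under
  isomorphism, so it does not matter which representative of a class is tested.
\<close>

definition closed_property :: "nat \<Rightarrow> ((nat, nat) schreier_graph \<Rightarrow> bool) \<Rightarrow> bool" where
  "closed_property n P \<longleftrightarrow> (\<forall>H. schreier n H \<longrightarrow> \<not> P H \<longrightarrow> (\<exists>r. \<forall>H' \<phi> \<psi>. schreier n H' \<longrightarrow>
     schreier_iso \<phi> \<psi> (neighborhood r H') (neighborhood r H) \<longrightarrow> \<not> P H'))"

definition structures :: "nat \<Rightarrow> ((nat, nat) schreier_graph \<Rightarrow> bool) \<Rightarrow>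
    (nat, nat) schreier_graph set set" where
  "structures n P = {C \<in> Lambda n. \<exists>H\<in>C. P H}"

lemma closed_property_iso:
  assumes P: "closed_property n P" and H: "(H, H') \<in> Lambda_rel n" "P H"
  shows "P H'"
proof (rule ccontr)
  assume "\<not> P H'"
  obtain \<phi> \<psi> where *: "schreier n H" "schreier n H'" "schreier_iso \<phi> \<psi> H H'"
    using H(1) by (auto simp: Lambda_rel_def)
  then show False
    using P \<open>\<not> P H'\<close> H(2) schreier_iso_ball[OF *] unfolding closed_property_def by blast
qed

lemma schreier_class_in_structures:
  assumes "closed_property n P" "schreier n H"
  shows "schreier_class n H \<in> structures n P \<longleftrightarrow> P H"
proof
  assume "schreier_class n H \<in> structures n P"
  then obtain K where "(H, K) \<in> Lambda_rel n" "P K" by (auto simp: structures_def)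
  then show "P H" using closed_property_iso[OF assms(1), of K H] equiv_Lambda_rel[of n]
    by (auto simp: equiv_def dest: symD)
next
  assume "P H"
  then show "schreier_class n H \<in> structures n P"
    using schreier_class_in_Lambda[OF assms(2)] in_own_schreier_class[OF assms(2)]
    unfolding structures_def by blast
qed

lemma closedin_structures:
  assumes "closed_property n P"
  shows "closedin (Lambda_topology n) (structures n P)"
proof -
  have "openin (Lambda_topology n) (Lambda n - structures n P)"
  proof (rule openin_LambdaI)
    fix H assume H: "schreier n H" "schreier_class n H \<in> Lambda n - structures n P"
    then have "\<not> P H" using schreier_class_in_structures[OF assms] by auto
    then obtain r where "\<forall>H' \<phi> \<psi>. schreier n H' \<longrightarrow>
        schreier_iso \<phi> \<psi> (neighborhood r H') (neighborhood r H) \<longrightarrow> \<not> P H'"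
      using assms H(1) unfolding closed_property_def by blast
    then show "\<exists>r. \<forall>H' \<phi> \<psi>. schreier n H' \<longrightarrow>
        schreier_iso \<phi> \<psi> (neighborhood r H') (neighborhood r H) \<longrightarrow>
        schreier_class n H' \<in> Lambda n - structures n P"
      using schreier_class_in_structures[OF assms] schreier_class_in_Lambda by (metis DiffI)
  qed auto
  moreover have "structures n P \<subseteq> Lambda n" by (auto simp: structures_def)
  ultimately show ?thesis by (simp add: closedin_def topspace_Lambda_topology)
qed

text \<open>
  Intersections of closed sets are closed. Asking only for one violated closed consequence covers
  both conjunctions and bounded quantifiers.
\<close>

lemma closed_property_from_implied:
  assumes "\<And>H. \<not> R H \<Longrightarrow> \<exists>P. closed_property n P \<and> \<not> P H \<and> (\<forall>H'. R H' \<longrightarrow> P H')"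
  shows "closed_property n R"
  unfolding closed_property_def
proof (intro allI impI)
  fix H assume H: "schreier n H" "\<not> R H"
  then obtain P where P: "closed_property n P" "\<not> P H" and RP: "\<And>H'. R H' \<Longrightarrow> P H'"
    using assms by blast
  obtain r where r: "\<forall>H' \<phi> \<psi>. schreier n H' \<longrightarrow>
      schreier_iso \<phi> \<psi> (neighborhood r H') (neighborhood r H) \<longrightarrow> \<not> P H'"
    using P(1)[unfolded closed_property_def, rule_format, OF H(1) P(2)] by (elim exE)
  show "\<exists>r. \<forall>H' \<phi> \<psi>. schreier n H' \<longrightarrow>
      schreier_iso \<phi> \<psi> (neighborhood r H') (neighborhood r H) \<longrightarrow> \<not> R H'"
  proof (intro exI allI impI notI)
    fix H' \<phi> \<psi>
    assume "schreier n H'" "schreier_iso \<phi> \<psi> (neighborhood r H') (neighborhood r H)" "R H'"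
    then show False using r[rule_format, of H' \<phi> \<psi>] RP[of H'] by simp
  qed
qed

lemma closed_property_conj:
  assumes "closed_property n P" "closed_property n Q"
  shows "closed_property n (\<lambda>H. P H \<and> Q H)"
proof (rule closed_property_from_implied)
  fix H assume "\<not> (P H \<and> Q H)"
  then consider "\<not> P H" | "\<not> Q H" by blast
  then show "\<exists>P'. closed_property n P' \<and> \<not> P' H \<and> (\<forall>H'. P H' \<and> Q H' \<longrightarrow> P' H')"
    by cases (rule exI[of _ P], simp add: assms(1), rule exI[of _ Q], simp add: assms(2))
qed

lemma closed_property_ball:
  assumes "\<And>i. i \<in> I \<Longrightarrow> closed_property n (P i)"
  shows "closed_property n (\<lambda>H. \<forall>i\<in>I. P i H)"
proof (rule closed_property_from_implied)
  fix H assume "\<not> (\<forall>i\<in>I. P i H)"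
  then obtain i where "i \<in> I" "\<not> P i H" by blast
  then show "\<exists>P'. closed_property n P' \<and> \<not> P' H \<and> (\<forall>H'. (\<forall>i\<in>I. P i H') \<longrightarrow> P' H')"
    by (intro exI[of _ "P i"]) (simp add: assms)
qed

lemma closed_property_walks_differ:
  assumes "set g \<subseteq> {..<n} \<times> UNIV" "set h \<subseteq> {..<n} \<times> UNIV"
  shows "closed_property n (\<lambda>H. walk H g (root_vertex H) \<noteq> walk H h (root_vertex H))"
  unfolding closed_property_def
proof (intro allI impI exI notI)
  let ?r = "max (length g) (length h)"
  fix H H' \<phi> \<psi>
  assume H: "schreier n H" "\<not> walk H g (root_vertex H) \<noteq> walk H h (root_vertex H)"
    and H': "schreier n H'" "walk H' g (root_vertex H') \<noteq> walk H' h (root_vertex H')"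
    and iso: "schreier_iso \<phi> \<psi> (neighborhood ?r H') (neighborhood ?r H)"
  have inj: "inj_on \<phi> (ball_vertices ?r H')"
    using iso by (auto simp: schreier_iso_def rooted_iso_def graph_iso_def bij_betw_def)
  have "\<phi> (walk H' g (root_vertex H')) = \<phi> (walk H' h (root_vertex H'))"
    using walk_neighborhood_iso[OF H'(1) H(1) iso, of g]
      walk_neighborhood_iso[OF H'(1) H(1) iso, of h] assms H(2) by simp
  moreover have "walk H' g (root_vertex H') \<in> ball_vertices ?r H'"
    "walk H' h (root_vertex H') \<in> ball_vertices ?r H'"
    using walk_in_ball[OF H'(1)] assms ball_mono[of "length g" ?r H'] ball_mono[of "length h" ?r H']
    by (auto simp: subset_eq)
  ultimately show False using inj H'(2) by (auto dest: inj_onD)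
qed

lemma act_schreier_class:
  assumes "schreier n H" "g \<in> carrier (free_group n)"
  shows "act n g (schreier_class n H) = schreier_class n (H\<lparr>root_vertex := walk H g (root_vertex H)\<rparr>)"
  using act_class[OF assms] by (simp add: foldr_move_root)

lemma carrier_letters: "g \<in> carrier (free_group n) \<Longrightarrow> set g \<subseteq> {..<n} \<times> UNIV"
  by (simp add: free_group_def)

lemma schreier_walk_root:
  assumes "schreier n H" "set g \<subseteq> {..<n} \<times> UNIV"
  shows "schreier n (H\<lparr>root_vertex := walk H g (root_vertex H)\<rparr>)"
  using schreier_move_word[OF assms] by (simp add: foldr_move_root)

text \<open>
  Moving the root along \<open>g\<close> shifts it by at most the length of \<open>g\<close>, so the \<open>r\<close>-ball around the
  new root lies in the ball of radius \<open>length g + r\<close> around the old one.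
\<close>

lemma continuous_map_act:
  assumes g: "g \<in> carrier (free_group n)"
  shows "continuous_map (Lambda_topology n) (Lambda_topology n) (act n g)"
proof -
  note g' = carrier_letters[OF g]
  have "openin (Lambda_topology n) (act n g -` cylinder n r U \<inter> Lambda n)" for r U
  proof (rule openin_LambdaI)
    fix H assume H: "schreier n H" "schreier_class n H \<in> act n g -` cylinder n r U \<inter> Lambda n"
    define gH where "gH = H\<lparr>root_vertex := walk H g (root_vertex H)\<rparr>"
    have gH: "schreier n gH" using schreier_walk_root[OF H(1) g'] by (simp add: gH_def)
    have "schreier_class n gH \<in> cylinder n r U"
      using H act_schreier_class[OF H(1) g] by (simp add: gH_def)
    then obtain K \<alpha> \<beta> where "(gH, K) \<in> Lambda_rel n" and K: "schreier_iso \<alpha> \<beta> (neighborhood r K) U"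
      unfolding cylinder_def by blast
    then obtain \<gamma> \<delta> where "schreier n K" "schreier_iso \<gamma> \<delta> gH K" by (auto simp: Lambda_rel_def)
    from schreier_iso_trans[OF schreier_iso_ball[OF gH this] K]
    obtain \<alpha>' \<beta>' where U: "schreier_iso \<alpha>' \<beta>' (neighborhood r gH) U" by blast
    let ?R = "length g + r"
    show "\<exists>R. \<forall>H' \<phi> \<psi>. schreier n H' \<longrightarrow>
        schreier_iso \<phi> \<psi> (neighborhood R H') (neighborhood R H) \<longrightarrow>
        schreier_class n H' \<in> act n g -` cylinder n r U \<inter> Lambda n"
    proof (intro exI allI impI)
      fix H' :: "(nat, nat) schreier_graph" and \<phi> \<psi>
      assume H': "schreier n H'" and iso: "schreier_iso \<phi> \<psi> (neighborhood ?R H') (neighborhood ?R H)"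
      define gH' where "gH' = H'\<lparr>root_vertex := walk H' g (root_vertex H')\<rparr>"
      let ?N' = "(neighborhood ?R H')\<lparr>root_vertex := walk H' g (root_vertex H')\<rparr>"
      let ?N = "(neighborhood ?R H)\<lparr>root_vertex := walk H g (root_vertex H)\<rparr>"
      have "\<phi> (walk H' g (root_vertex H')) = walk H g (root_vertex H)"
        by (rule walk_neighborhood_iso[OF H' H(1) iso g']) simp
      then have "schreier_iso \<phi> \<psi> ?N' ?N"
        using iso by (simp add: schreier_iso_def rooted_iso_def graph_iso_def)
      moreover have "walk H' g (root_vertex H') \<in> ball_vertices ?R H'"
        using walk_in_ball[OF H' g'] ball_mono[of "length g" ?R H'] by auto
      ultimately have "schreier_iso \<phi> \<psi> (neighborhood r ?N') (neighborhood r ?N)"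
        using schreier_multigraph[OF H'] schreier_multigraph[OF H(1)]
        by (intro schreier_iso_neighborhood) (auto simp: multigraph_neighborhood)
      then have "schreier_iso \<phi> \<psi> (neighborhood r gH') (neighborhood r gH)"
        unfolding gH_def gH'_def
        by (simp only: neighborhood_neighborhood[OF walk_in_ball[OF H' g'] order_refl]
            neighborhood_neighborhood[OF walk_in_ball[OF H(1) g'] order_refl])
      from schreier_iso_trans[OF this U]
      have "\<exists>\<phi> \<psi>. schreier_iso \<phi> \<psi> (neighborhood r gH') U" by blast
      moreover have "schreier n gH'" using schreier_walk_root[OF H' g'] by (simp add: gH'_def)
      ultimately have "schreier_class n gH' \<in> cylinder n r U"
        using schreier_class_in_Lambda in_own_schreier_class unfolding cylinder_def by blast
      then show "schreier_class n H' \<in> act n g -` cylinder n r U \<inter> Lambda n"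
        using act_schreier_class[OF H' g] schreier_class_in_Lambda[OF H'] by (simp add: gH'_def)
    qed
  qed auto
  moreover have "act n g ` Lambda n \<subseteq> Lambda n" using act_in_Lambda[OF _ g] by auto
  ultimately show ?thesis
    using topspace_Lambda_topology[of n]
    unfolding Lambda_topology_def
    by (subst continuous_on_generated_topo_iff) auto
qed

lemma space_Lambda_borel: "space (Lambda_borel n) = Lambda n"
  and sets_Lambda_borel:
    "sets (Lambda_borel n) = sigma_sets (Lambda n) {S. openin (Lambda_topology n) S}"
proof -
  have "{S. openin (Lambda_topology n) S} \<subseteq> Pow (Lambda n)"
    using openin_subset topspace_Lambda_topology by blast
  then show "space (Lambda_borel n) = Lambda n"
    "sets (Lambda_borel n) = sigma_sets (Lambda n) {S. openin (Lambda_topology n) S}"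
    by (simp_all add: Lambda_borel_def space_measure_of sets_measure_of)
qed

lemma closedin_Lambda_borel:
  assumes "closedin (Lambda_topology n) S"
  shows "S \<in> sets (Lambda_borel n)"
proof -
  have "Lambda n - (Lambda n - S) \<in> sets (Lambda_borel n)" unfolding sets_Lambda_borel
    by (intro sigma_sets.Compl sigma_sets.Basic)
      (use assms in \<open>simp add: closedin_def topspace_Lambda_topology\<close>)
  moreover have "S \<subseteq> Lambda n"
    using closedin_subset[OF assms] by (simp add: topspace_Lambda_topology)
  ultimately show ?thesis by (simp add: double_diff)
qed

lemma measurable_act:
  assumes g: "g \<in> carrier (free_group n)"
  shows "act n g \<in> measurable (Lambda_borel n) (Lambda_borel n)"
proof (rule measurable_sigma_sets[OF sets_Lambda_borel])
  show "{S. openin (Lambda_topology n) S} \<subseteq> Pow (Lambda n)"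
    using openin_subset topspace_Lambda_topology by blast
  show "act n g \<in> space (Lambda_borel n) \<rightarrow> Lambda n"
    using act_in_Lambda[OF _ g] by (simp add: space_Lambda_borel)
next
  fix S assume "S \<in> {S. openin (Lambda_topology n) S}"
  then have "openin (Lambda_topology n) {C \<in> Lambda n. act n g C \<in> S}"
    using continuous_map_act[OF g] topspace_Lambda_topology[of n] by (auto simp: continuous_map_def)
  moreover have "{C \<in> Lambda n. act n g C \<in> S} = act n g -` S \<inter> space (Lambda_borel n)"
    by (auto simp: space_Lambda_borel)
  ultimately show "act n g -` S \<inter> space (Lambda_borel n) \<in> sets (Lambda_borel n)"
    by (simp add: sets_Lambda_borel sigma_sets.Basic)
qed

section \<open>Schreier structures over a fixed graph\<close>

text \<open>
  A Schreier structure \<open>H\<close> over \<open>G\<close> is identified with \<open>G\<close> only up to automorphisms of \<open>G\<close>. What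
  can still be transported from \<open>G\<close> to \<open>H\<close> is the relation on pairs of vertices that is given by the
  \<open>Aut G\<close>-orbit of the pair \<open>(x, y)\<close>.
\<close>

definition orbit_pair :: "('w, 'f, 'z) rooted_graph_scheme \<Rightarrow> 'w \<Rightarrow> 'w \<Rightarrow>
    ('v, 'e, 'y) rooted_graph_scheme \<Rightarrow> 'v \<Rightarrow> 'v \<Rightarrow> bool" where
  "orbit_pair G x y H u v \<longleftrightarrow> (\<exists>\<phi> \<psi>. graph_iso \<phi> \<psi> H G \<and> \<phi> u = x \<and> \<phi> v = y)"

lemma orbit_pair_swap: "orbit_pair G x y H u v \<longleftrightarrow> orbit_pair G y x H v u"
  by (auto simp: orbit_pair_def)

lemma orbit_pair_update_root [simp]:
  "orbit_pair G x y (H\<lparr>root_vertex := r\<rparr>) u v \<longleftrightarrow> orbit_pair G x y H u v"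
  by (simp add: orbit_pair_def)

text \<open>
  Under an isomorphism that sends \<open>u\<close> to \<open>x\<close>, the partners of \<open>u\<close> become the images of \<open>y\<close> under
  the stabilizer of \<open>x\<close>; transitivity provides such an isomorphism for every \<open>u\<close>.
\<close>

lemma card_orbit_pair:
  assumes G: "multigraph G" "vertex_transitive G" "x \<in> verts G" "y \<in> verts G"
    and H: "multigraph H" "graph_iso \<alpha> \<beta> H G" "u \<in> verts H"
  shows "card {v \<in> verts H. orbit_pair G x y H u v} = card (stabilizer_orbit G x y)"
proof -
  have "\<alpha> u \<in> verts G" using H(2,3) by (auto simp: graph_iso_def dest: bij_betwE)
  then obtain \<sigma> \<tau> where "graph_iso \<sigma> \<tau> G G" "\<sigma> (\<alpha> u) = x"
    using G(2,3) unfolding vertex_transitive_def by blast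
  then have "\<exists>\<phi> \<psi>. graph_iso \<phi> \<psi> H G \<and> \<phi> u = x"
    using graph_iso_trans[OF H(2)] by (metis comp_apply)
  then obtain \<phi> \<psi> where iso: "graph_iso \<phi> \<psi> H G" and u: "\<phi> u = x" by blast
  have bij: "bij_betw \<phi> (verts H) (verts G)" using iso by (simp add: graph_iso_def)
  have "\<phi> ` {v \<in> verts H. orbit_pair G x y H u v} = stabilizer_orbit G x y"
  proof (intro equalityI subsetI)
    fix z assume "z \<in> \<phi> ` {v \<in> verts H. orbit_pair G x y H u v}"
    then obtain v \<phi>' \<psi>' where v: "v \<in> verts H" "z = \<phi> v"
      and iso': "graph_iso \<phi>' \<psi>' H G" "\<phi>' u = x" "\<phi>' v = y"
      unfolding orbit_pair_def by blast
    let ?i = "inv_into (verts H) \<phi>'"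
    have "inj_on \<phi>' (verts H)" using iso'(1) by (auto simp: graph_iso_def bij_betw_def)
    then have "?i x = u" "?i y = v" using iso'(2,3) v(1) H(3) by (auto simp: inv_into_f_eq)
    moreover have "graph_iso (\<phi> \<circ> ?i) (\<psi> \<circ> inv_into (edges H) \<psi>') G G"
      by (rule graph_iso_trans[OF graph_iso_sym[OF iso'(1) H(1)] iso])
    ultimately have "graph_iso (\<phi> \<circ> ?i) (\<psi> \<circ> inv_into (edges H) \<psi>') G G \<and>
      (\<phi> \<circ> ?i) x = x \<and> z = (\<phi> \<circ> ?i) y" using u v(2) by simp
    then show "z \<in> stabilizer_orbit G x y" unfolding stabilizer_orbit_def by blast
  next
    fix z assume "z \<in> stabilizer_orbit G x y"
    then obtain \<sigma> \<tau> where \<sigma>: "z = \<sigma> y" "graph_iso \<sigma> \<tau> G G" "\<sigma> x = x"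
      unfolding stabilizer_orbit_def by blast
    then have b: "bij_betw \<sigma> (verts G) (verts G)" by (simp add: graph_iso_def)
    then have "z \<in> verts G" using \<sigma>(1) G(4) by (auto dest: bij_betwE)
    then have "z \<in> \<phi> ` verts H" using bij by (simp add: bij_betw_imp_surj_on)
    then obtain v where v: "v \<in> verts H" "\<phi> v = z" by blast
    let ?i = "inv_into (verts G) \<sigma>"
    have i: "?i x = x" "?i z = y" using b \<sigma> G(3,4) by (auto simp: bij_betw_def inv_into_f_eq)
    have "graph_iso (?i \<circ> \<phi>) (inv_into (edges G) \<tau> \<circ> \<psi>) H G"
      by (rule graph_iso_trans[OF iso graph_iso_sym[OF \<sigma>(2) G(1)]])
    then have "orbit_pair G x y H u v" unfolding orbit_pair_def using i u v(2)
      by (intro exI[of _ "?i \<circ> \<phi>"] exI[of _ "inv_into (edges G) \<tau> \<circ> \<psi>"]) simp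
    then show "z \<in> \<phi> ` {v \<in> verts H. orbit_pair G x y H u v}" using v by blast
  qed
  then have "bij_betw \<phi> {v \<in> verts H. orbit_pair G x y H u v} (stabilizer_orbit G x y)"
    using bij by (auto simp: bij_betw_def intro: inj_on_subset)
  then show ?thesis by (rule bij_betw_same_card)
qed

text \<open>
  If \<open>root\<close> and \<open>g root\<close> do not correspond to \<open>x\<close> and \<open>y\<close>, then by compactness already some ball
  admits no isomorphism that sends them there, and every Schreier graph with the same labeled ball
  inherits this obstruction.
\<close>

lemma closed_property_orbit_pair:
  fixes G :: "('w, 'f, 'z) rooted_graph_scheme"
  assumes G: "regular_rooted_graph d G" "x \<in> verts G" and g: "set g \<subseteq> {..<n} \<times> UNIV"
  shows "closed_property n (\<lambda>H. orbit_pair G x y H (root_vertex H) (walk H g (root_vertex H)))"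
  unfolding closed_property_def
proof (intro allI impI)
  fix H :: "(nat, nat) schreier_graph"
  assume H: "schreier n H"
    and no: "\<not> orbit_pair G x y H (root_vertex H) (walk H g (root_vertex H))"
  let ?G = "G\<lparr>root_vertex := x\<rparr>"
  let ?v = "walk H g (root_vertex H)"
  have reg: "regular_rooted_graph (2 * n) H" using H by (simp add: schreier_def)
  have reg': "regular_rooted_graph d ?G" by (rule regular_rooted_graph_update_root[OF G])
  have mG: "multigraph G" using G(1) by (simp add: regular_rooted_graph_def)
  have "\<not> (\<forall>r\<ge>length g. \<exists>\<phi> \<psi>. rooted_iso \<phi> \<psi> (neighborhood r H) (neighborhood r ?G) \<and> \<phi> ?v = y)"
  proof
    assume *: "\<forall>r\<ge>length g. \<exists>\<phi> \<psi>. rooted_iso \<phi> \<psi> (neighborhood r H) (neighborhood r ?G) \<and> \<phi> ?v = y"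
    obtain \<phi> \<psi> where "rooted_iso \<phi> \<psi> H ?G" "\<phi> ?v = y"
    proof (rule rooted_iso_from_balls[OF reg reg' walk_in_verts[OF H schreier_root[OF H] g]])
      show "\<exists>\<phi> \<psi>. rooted_iso \<phi> \<psi> (neighborhood r H) (neighborhood r ?G) \<and> \<phi> ?v = y"
        if "r \<ge> length g" for r
        using * that by blast
    qed
    then show False using no by (auto simp: orbit_pair_def rooted_iso_def)
  qed
  then obtain r where r: "r \<ge> length g"
    "\<And>\<phi> \<psi>. rooted_iso \<phi> \<psi> (neighborhood r H) (neighborhood r ?G) \<Longrightarrow> \<phi> ?v \<noteq> y"
    by blast
  show "\<exists>r. \<forall>(H' :: (nat, nat) schreier_graph) \<phi> \<psi>. schreier n H' \<longrightarrow>
      schreier_iso \<phi> \<psi> (neighborhood r H') (neighborhood r H) \<longrightarrow>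
      \<not> orbit_pair G x y H' (root_vertex H') (walk H' g (root_vertex H'))"
  proof (intro exI allI impI notI)
    fix H' :: "(nat, nat) schreier_graph" and \<phi> \<psi>
    assume H': "schreier n H'" and iso: "schreier_iso \<phi> \<psi> (neighborhood r H') (neighborhood r H)"
      and pair: "orbit_pair G x y H' (root_vertex H') (walk H' g (root_vertex H'))"
    let ?v' = "walk H' g (root_vertex H')"
    let ?i = "inv_into (ball_vertices r H') \<phi>"
    obtain \<alpha> \<beta> where \<alpha>: "graph_iso \<alpha> \<beta> H' G" "\<alpha> (root_vertex H') = x" "\<alpha> ?v' = y"
      using pair by (auto simp: orbit_pair_def)
    then have "rooted_iso \<alpha> \<beta> H' ?G" by (simp add: rooted_iso_def)
    then have \<alpha>r: "rooted_iso \<alpha> \<beta> (neighborhood r H') (neighborhood r ?G)"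
      using schreier_multigraph[OF H'] schreier_root[OF H'] mG
      by (intro rooted_iso_neighborhood) auto
    have "rooted_iso ?i (inv_into (edges (neighborhood r H')) \<psi>) (neighborhood r H) (neighborhood r H')"
      using rooted_iso_sym[of \<phi> \<psi> "neighborhood r H'" "neighborhood r H"] iso
        multigraph_neighborhood[OF schreier_multigraph[OF H'], of r] root_in_ball[of H' r]
      by (simp add: schreier_iso_def)
    then have "rooted_iso (\<alpha> \<circ> ?i) (\<beta> \<circ> inv_into (edges (neighborhood r H')) \<psi>)
        (neighborhood r H) (neighborhood r ?G)"
      using \<alpha>r by (rule rooted_iso_trans)
    then have "\<alpha> (?i ?v) \<noteq> y" using r(2) by fastforce
    moreover have "?i ?v = ?v'"
    proof (rule inv_into_f_eq)
      show "inj_on \<phi> (ball_vertices r H')"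
        using iso by (auto simp: schreier_iso_def rooted_iso_def graph_iso_def bij_betw_def)
      show "?v' \<in> ball_vertices r H'" using walk_in_ball[OF H' g] ball_mono[OF r(1), of H'] by blast
      show "\<phi> ?v' = ?v" by (rule walk_neighborhood_iso[OF H' H iso g r(1)])
    qed
    ultimately show False using \<alpha>(3) by simp
  qed
qed

lemma schreier_class_in_schreier_structures:
  assumes G: "regular_rooted_graph (2 * n) G" and H: "schreier n H"
  shows "schreier_class n H \<in> schreier_structures n (Omega_rel n `` {G}) \<longleftrightarrow>
    orbit_pair G (root_vertex G) (root_vertex G) H (root_vertex H) (root_vertex H)"
proof -
  have reg: "regular_rooted_graph (2 * n) (rooted_graph.truncate H)"
    using H by (simp add: regular_rooted_graph_truncate schreier_def)
  have "schreier_class n H \<in> schreier_structures n (Omega_rel n `` {G}) \<longleftrightarrow>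
      Omega_rel n `` {rooted_graph.truncate H} = Omega_rel n `` {G}"
    using forget_class[OF H] schreier_class_in_Lambda[OF H] by (simp add: schreier_structures_def)
  also have "\<dots> \<longleftrightarrow> (rooted_graph.truncate H, G) \<in> Omega_rel n"
    using eq_equiv_class_iff[OF equiv_Omega_rel] reg G by simp
  also have "\<dots> \<longleftrightarrow> orbit_pair G (root_vertex G) (root_vertex G) H (root_vertex H) (root_vertex H)"
    using reg G by (simp add: Omega_rel_def orbit_pair_def rooted_iso_def truncate_simps)
  finally show ?thesis .
qed

lemma schreier_structures_eq:
  assumes G: "regular_rooted_graph (2 * n) G"
  shows "schreier_structures n (Omega_rel n `` {G}) = structures n
    (\<lambda>H. orbit_pair G (root_vertex G) (root_vertex G) H (root_vertex H) (walk H [] (root_vertex H)))"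
    (is "?S = structures n ?P")
proof -
  have P: "closed_property n ?P"
    using G by (intro closed_property_orbit_pair) (auto simp: regular_rooted_graph_def)
  have "C \<in> ?S \<longleftrightarrow> C \<in> structures n ?P" if "C \<in> Lambda n" for C
    using that
  proof (rule Lambda_cases)
    fix H assume "schreier n H" "C = schreier_class n H"
    then show ?thesis
      using schreier_class_in_structures[OF P] schreier_class_in_schreier_structures[OF G] by simp
  qed
  then show ?thesis by (auto simp: schreier_structures_def structures_def)
qed

lemma closedin_schreier_structures:
  assumes G: "regular_rooted_graph (2 * n) G"
  shows "closedin (Lambda_topology n) (schreier_structures n (Omega_rel n `` {G}))"
  unfolding schreier_structures_eq[OF G] using G
  by (intro closedin_structures closed_property_orbit_pair) (auto simp: regular_rooted_graph_def)

text \<open>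
  Moving the root does not change the underlying unrooted graph, and by transitivity all choices of
  the root give isomorphic rooted graphs.
\<close>

lemma invariant_subspace_schreier_structures:
  assumes G: "regular_rooted_graph (2 * n) G" "vertex_transitive G"
  shows "invariant_subspace n (schreier_structures n (Omega_rel n `` {G}))"
proof -
  let ?S = "schreier_structures n (Omega_rel n `` {G})"
  have sub: "?S \<subseteq> Lambda n" by (auto simp: schreier_structures_def)
  have stays: "act n g C \<in> ?S" if C: "C \<in> ?S" and g: "g \<in> carrier (free_group n)" for g C
  proof -
    have "C \<in> Lambda n" using C sub by blast
    then obtain H where H: "schreier n H" "C = schreier_class n H" by (rule Lambda_cases)
    let ?v = "walk H g (root_vertex H)"
    obtain \<alpha> \<beta> where iso: "graph_iso \<alpha> \<beta> H G"
      using C H schreier_class_in_schreier_structures[OF G(1) H(1)] by (auto simp: orbit_pair_def)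
    have "?v \<in> verts H" by (rule walk_in_verts[OF H(1) schreier_root[OF H(1)] carrier_letters[OF g]])
    then have "\<alpha> ?v \<in> verts G" using iso by (auto simp: graph_iso_def dest: bij_betwE)
    moreover have "root_vertex G \<in> verts G" using G(1) by (simp add: regular_rooted_graph_def)
    ultimately obtain \<sigma> \<tau> where "graph_iso \<sigma> \<tau> G G" "\<sigma> (\<alpha> ?v) = root_vertex G"
      using G(2) unfolding vertex_transitive_def by blast
    then have "orbit_pair G (root_vertex G) (root_vertex G) H ?v ?v"
      unfolding orbit_pair_def
      by (intro exI[of _ "\<sigma> \<circ> \<alpha>"] exI[of _ "\<tau> \<circ> \<beta>"]) (simp add: graph_iso_trans[OF iso])
    then show ?thesis
      using schreier_class_in_schreier_structures[OF G(1) schreier_walk_root[OF H(1) carrier_letters[OF g]]]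
        act_schreier_class[OF H(1) g] H(2) by simp
  qed
  have "act n g ` ?S = ?S" if g: "g \<in> carrier (free_group n)" for g
  proof
    show "act n g ` ?S \<subseteq> ?S" using stays g by blast
    show "?S \<subseteq> act n g ` ?S"
    proof
      fix C assume C: "C \<in> ?S"
      interpret group "free_group n" by (rule group_free_group)
      have "act n g (act n (inv\<^bsub>free_group n\<^esub> g) C) = C"
        using act_mult[of C n g "inv\<^bsub>free_group n\<^esub> g"] act_one[of C n] C sub g by auto
      then show "C \<in> act n g ` ?S" using stays[OF C, of "inv\<^bsub>free_group n\<^esub> g"] g by force
    qed
  qed
  then show ?thesis using sub by (simp add: invariant_subspace_def)
qed

section \<open>Counting partners by words\<close>

text \<open>
  Different words may lead from \<open>u\<close> to the same vertex, so that counting words would count vertices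
  with multiplicity. The first word with respect to a fixed enumeration is used instead.
\<close>

definition first_word :: "letter list set \<Rightarrow> ('v, 'e) schreier_graph \<Rightarrow> letter list \<Rightarrow> 'v \<Rightarrow> bool" where
  "first_word W H g u \<longleftrightarrow> (\<forall>h\<in>{h \<in> W. to_nat h < to_nat g}. walk H h u \<noteq> walk H g u)"

lemma first_word_exists:
  assumes "\<exists>g\<in>W. walk H g u = v"
  shows "\<exists>g\<in>W. walk H g u = v \<and> first_word W H g u"
proof -
  from assms obtain g where "g \<in> W \<and> walk H g u = v" by blast
  from ex_has_least_nat[of "\<lambda>g. g \<in> W \<and> walk H g u = v", OF this, of to_nat]
  show ?thesis by (auto simp: first_word_def not_less[symmetric])
qed

lemma first_word_unique:
  assumes "g \<in> W" "h \<in> W" "first_word W H g u" "first_word W H h u" "walk H g u = walk H h u"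
  shows "g = h"
proof -
  have "\<not> to_nat g < to_nat h" "\<not> to_nat h < to_nat g"
    using assms unfolding first_word_def by force+
  then show ?thesis by (metis linorder_neqE_nat inj_to_nat injD)
qed

text \<open>
  The two counts below differ in the vertex that stays fixed. In the first one the start \<open>u\<close> of the
  words is fixed and the end varies, in the second one the end \<open>v\<close> is fixed and the start varies.
  Both times each pair is counted once, by the first word that joins it.
\<close>

lemma card_words_from:
  assumes H: "schreier n H" and W: "W \<subseteq> carrier (free_group n)" and u: "u \<in> verts H"
    and ex: "\<And>v. v \<in> verts H \<Longrightarrow> P v \<Longrightarrow> \<exists>g\<in>W. walk H g u = v"
  shows "card {g \<in> W. P (walk H g u) \<and> first_word W H g u} = card {v \<in> verts H. P v}"
proof (rule bij_betw_same_card[of "\<lambda>g. walk H g u"], rule bij_betwI')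
  fix g h assume "g \<in> {g \<in> W. P (walk H g u) \<and> first_word W H g u}"
    "h \<in> {g \<in> W. P (walk H g u) \<and> first_word W H g u}"
  then show "(walk H g u = walk H h u) = (g = h)" using first_word_unique[of g W h H u] by auto
next
  fix g assume "g \<in> {g \<in> W. P (walk H g u) \<and> first_word W H g u}"
  then show "walk H g u \<in> {v \<in> verts H. P v}"
    using walk_in_verts[OF H u carrier_letters] W by blast
next
  fix v assume "v \<in> {v \<in> verts H. P v}"
  then show "\<exists>g\<in>{g \<in> W. P (walk H g u) \<and> first_word W H g u}. v = walk H g u"
    using first_word_exists[OF ex[of v]] by blast
qed

definition inverse_word :: "letter list \<Rightarrow> letter list" where
  "inverse_word g = rev (map flip g)"

lemma inverse_word_carrier:
  "g \<in> carrier (free_group n) \<Longrightarrow> inverse_word g \<in> carrier (free_group n)"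
  using reduced_rev_flip[of g] by (fastforce simp: free_group_def inverse_word_def)

lemma walk_inverse_word:
  assumes H: "schreier n H" and v: "v \<in> verts H" and g: "g \<in> carrier (free_group n)"
  shows "walk H (inverse_word g) (walk H g v) = v" "walk H g (walk H (inverse_word g) v) = v"
proof -
  show "walk H (inverse_word g) (walk H g v) = v"
    unfolding inverse_word_def by (rule walk_inverse[OF H v carrier_letters[OF g]])
  have "rev (map flip (inverse_word g)) = g"
    by (simp add: inverse_word_def rev_map comp_def)
  then show "walk H g (walk H (inverse_word g) v) = v"
    using walk_inverse[OF H v carrier_letters[OF inverse_word_carrier[OF g]]] by simp
qed

lemma card_words_to:
  assumes H: "schreier n H" and W: "W \<subseteq> carrier (free_group n)" and v: "v \<in> verts H"
    and ex: "\<And>u. u \<in> verts H \<Longrightarrow> P u \<Longrightarrow> \<exists>g\<in>W. walk H g u = v"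
  shows "card {g \<in> W. P (walk H (inverse_word g) v) \<and> first_word W H g (walk H (inverse_word g) v)} =
    card {u \<in> verts H. P u}" (is "card ?A = card ?B")
proof (rule bij_betw_same_card[of "\<lambda>g. walk H (inverse_word g) v"], rule bij_betwI')
  have returns: "walk H g (walk H (inverse_word g) v) = v" if "g \<in> W" for g
    using walk_inverse_word(2)[OF H v] that W by blast
  show "(walk H (inverse_word g) v = walk H (inverse_word h) v) = (g = h)" if "g \<in> ?A" "h \<in> ?A" for g h
    using that returns[of g] returns[of h] first_word_unique[of g W h H "walk H (inverse_word g) v"] by auto
  show "walk H (inverse_word g) v \<in> ?B" if "g \<in> ?A" for g
    using that walk_in_verts[OF H v carrier_letters[OF inverse_word_carrier]] W by blast
  show "\<exists>g\<in>?A. u = walk H (inverse_word g) v" if u: "u \<in> ?B" for u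
  proof -
    obtain g where g: "g \<in> W" "walk H g u = v" "first_word W H g u"
      using first_word_exists[OF ex[of u]] u by blast
    then have "walk H (inverse_word g) v = u" using walk_inverse_word(1)[OF H, of u g] u W by blast
    then show ?thesis using g u by (intro bexI[of _ g]) auto
  qed
qed

section \<open>Mass transport\<close>

text \<open>
  All pairs in the orbit of \<open>(x, y)\<close> are joined by a path of the same length \<open>d\<close>, hence by a word
  with \<open>d\<close> letters; reducing these words gives a finite set of group elements that suffices for all
  Schreier structures over \<open>G\<close> at once.
\<close>

lemma finite_joining_words:
  assumes G: "regular_rooted_graph d' G" "x \<in> verts G" "y \<in> verts G"
  obtains W where "finite W" "W \<subseteq> carrier (free_group n)"
    "\<And>(H :: (nat, nat) schreier_graph) u v. schreier n H \<Longrightarrow> u \<in> verts H \<Longrightarrow> v \<in> verts H \<Longrightarrow>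
      orbit_pair G x y H u v \<Longrightarrow> \<exists>g\<in>W. walk H g u = v"
proof -
  have "(x, y) \<in> (adjacency G)\<^sup>*"
    using G by (auto simp: regular_rooted_graph_def connected_graph_def)
  then obtain d where d: "(x, y) \<in> adjacency G ^^ d" using rtrancl_imp_relpow by blast
  define W where
    "W = (\<lambda>w. foldr push w []) ` {w. set w \<subseteq> {..<n} \<times> (UNIV :: bool set) \<and> length w = d}"
  have "finite W" unfolding W_def by (intro finite_imageI finite_lists_length_eq) simp
  moreover have "W \<subseteq> carrier (free_group n)"
    using foldr_push_set[of _ "[]"] reduced_foldr_push[of "[]"]
    by (fastforce simp: W_def free_group_def reduced_word_def)
  moreover have "\<exists>g\<in>W. walk H g u = v"
    if H: "schreier n H" and uv: "u \<in> verts H" "v \<in> verts H" "orbit_pair G x y H u v"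
    for H :: "(nat, nat) schreier_graph" and u v
  proof -
    obtain \<phi> \<psi> where \<phi>: "graph_iso \<phi> \<psi> H G" "\<phi> u = x" "\<phi> v = y"
      using uv(3) by (auto simp: orbit_pair_def)
    let ?i = "inv_into (verts H) \<phi>"
    have "?i x = u" "?i y = v"
      using \<phi> uv by (auto simp: graph_iso_def bij_betw_def inv_into_f_eq)
    then have "(u, v) \<in> adjacency H ^^ d"
      using relpow_adjacency_iso[OF graph_iso_sym[OF \<phi>(1) schreier_multigraph[OF H]] d] by simp
    then obtain w where "set w \<subseteq> {..<n} \<times> UNIV" "length w = d" "walk H w u = v"
      using walk_exists[OF H] by blast
    then show ?thesis using walk_reduce[OF H uv(1)] by (auto simp: W_def)
  qed
  ultimately show ?thesis using that by blast
qed

text \<open>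
  The number of events that occur is the sum of their indicators, and its expectation is the sum of
  their probabilities.
\<close>

lemma (in prob_space) sum_emeasure_eq_count:
  assumes W: "finite W" "\<And>g. g \<in> W \<Longrightarrow> E g \<in> events"
    and count: "AE C in M. card {g \<in> W. C \<in> E g} = c"
  shows "(\<Sum>g\<in>W. emeasure M (E g)) = of_nat c"
proof -
  have "(\<Sum>g\<in>W. emeasure M (E g)) = (\<integral>\<^sup>+C. (\<Sum>g\<in>W. indicator (E g) C) \<partial>M)"
    using W by (subst nn_integral_sum) auto
  also have "\<dots> = (\<integral>\<^sup>+C. of_nat c \<partial>M)"
  proof (rule nn_integral_cong_AE)
    have "(\<Sum>g\<in>W. indicator (E g) C) = (of_nat (card {g \<in> W. C \<in> E g}) :: ennreal)" for C
      using W(1) by (simp add: indicator_def sum.If_cases Int_def)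
    then show "AE C in M. (\<Sum>g\<in>W. indicator (E g) C) = (of_nat c :: ennreal)"
      using count by simp
  qed
  also have "\<dots> = of_nat c" by (simp add: emeasure_space_1)
  finally show ?thesis .
qed

text \<open>
  Let \<open>E g\<close> be the event that \<open>(root, g root)\<close> is in the orbit of \<open>(x, y)\<close> and \<open>g\<close> is the first word
  joining this pair, and let \<open>F g\<close> be the preimage of \<open>E g\<close> under \<open>g\<^sup>-\<^sup>1\<close>: it says the same about
  \<open>(g\<^sup>-\<^sup>1 root, root)\<close>. The number of \<open>g\<close> such that \<open>E g\<close> occurs is the number of partners of the root
  in one direction, the number of \<open>g\<close> such that \<open>F g\<close> occurs is the number of its partners in the
  other direction, and invariance gives \<open>E g\<close> and \<open>F g\<close> the same probability.
\<close>

lemma invariant_imp_orbits_balanced: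
  assumes G: "regular_rooted_graph (2 * n) G" "vertex_transitive G"
    and xy: "x \<in> verts G" "y \<in> verts G"
    and \<mu>: "invariant_probability n \<mu>" "emeasure \<mu> (schreier_structures n (Omega_rel n `` {G})) = 1"
  shows "card (stabilizer_orbit G x y) = card (stabilizer_orbit G y x)"
proof -
  let ?S = "schreier_structures n (Omega_rel n `` {G})"
  interpret prob_space \<mu> using \<mu>(1) by (simp add: invariant_probability_def)
  have sets_\<mu>: "sets \<mu> = sets (Lambda_borel n)" using \<mu>(1) by (simp add: invariant_probability_def)
  have space_\<mu>: "space \<mu> = Lambda n" using sets_eq_imp_space_eq[OF sets_\<mu>] space_Lambda_borel by simp
  have mG: "multigraph G" using G(1) by (simp add: regular_rooted_graph_def)
  have in_S: "AE C in \<mu>. C \<in> ?S"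
    using \<mu>(2) by (intro AE_prob_1) (simp add: measure_def)
  obtain W where W: "finite W" "W \<subseteq> carrier (free_group n)"
    and join: "\<And>(H :: (nat, nat) schreier_graph) u v. schreier n H \<Longrightarrow> u \<in> verts H \<Longrightarrow> v \<in> verts H \<Longrightarrow>
      orbit_pair G x y H u v \<Longrightarrow> \<exists>g\<in>W. walk H g u = v"
    using finite_joining_words[OF G(1) xy] by metis
  define Q where "Q g H \<longleftrightarrow> orbit_pair G x y H (root_vertex H) (walk H g (root_vertex H)) \<and>
    first_word W H g (root_vertex H)" for g and H :: "(nat, nat) schreier_graph"
  define E where "E g = structures n (Q g)" for g
  define F where "F g = act n (inverse_word g) -` E g \<inter> space \<mu>" for g
  have closed_Q: "closed_property n (Q g)" if "g \<in> W" for g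
    unfolding Q_def first_word_def using W(2) that G(1) xy(1)
    by (intro closed_property_conj closed_property_ball closed_property_walks_differ
        closed_property_orbit_pair carrier_letters) auto
  have E_sets: "E g \<in> sets \<mu>" if "g \<in> W" for g
    unfolding E_def sets_\<mu> by (intro closedin_Lambda_borel closedin_structures closed_Q that)
  have act_meas: "act n g \<in> measurable \<mu> \<mu>" if "g \<in> carrier (free_group n)" for g
    using measurable_act[OF that] measurable_cong_sets[OF sets_\<mu> sets_\<mu>] by blast
  have F_sets: "F g \<in> sets \<mu>" if "g \<in> W" for g
    unfolding F_def using act_meas[OF inverse_word_carrier] E_sets[OF that] W(2) that
    by (intro measurable_sets) auto
  have EF: "emeasure \<mu> (E g) = emeasure \<mu> (F g)" if g: "g \<in> W" for g
  proof -
    have g': "inverse_word g \<in> carrier (free_group n)" using inverse_word_carrier W(2) g by blast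
    then have "distr \<mu> \<mu> (act n (inverse_word g)) = \<mu>"
      using \<mu>(1) by (simp add: invariant_probability_def)
    then show ?thesis
      using emeasure_distr[OF act_meas[OF g'] E_sets[OF g]] by (simp add: F_def)
  qed

  have E_count: "card {g \<in> W. C \<in> E g} = card (stabilizer_orbit G x y)"
    and F_count: "card {g \<in> W. C \<in> F g} = card (stabilizer_orbit G y x)" if C: "C \<in> ?S" for C
  proof -
    have "C \<in> Lambda n" using C by (simp add: schreier_structures_def)
    then obtain H where H: "schreier n H" "C = schreier_class n H" by (rule Lambda_cases)
    note root = schreier_root[OF H(1)] and mH = schreier_multigraph[OF H(1)]
    obtain \<alpha> \<beta> where iso: "graph_iso \<alpha> \<beta> H G"
      using C H schreier_class_in_schreier_structures[OF G(1) H(1)] by (auto simp: orbit_pair_def)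
    have "{g \<in> W. C \<in> E g} = {g \<in> W. orbit_pair G x y H (root_vertex H) (walk H g (root_vertex H)) \<and>
        first_word W H g (root_vertex H)}"
      using schreier_class_in_structures[OF closed_Q H(1)] H(2) by (auto simp: E_def Q_def)
    then have "card {g \<in> W. C \<in> E g} = card {v \<in> verts H. orbit_pair G x y H (root_vertex H) v}"
      using card_words_from[OF H(1) W(2) root, of "orbit_pair G x y H (root_vertex H)"]
        join[OF H(1) root] by simp
    also have "\<dots> = card (stabilizer_orbit G x y)"
      by (rule card_orbit_pair[OF mG G(2) xy mH iso root])
    finally show "card {g \<in> W. C \<in> E g} = card (stabilizer_orbit G x y)" .

    have "C \<in> F g \<longleftrightarrow> orbit_pair G x y H (walk H (inverse_word g) (root_vertex H)) (root_vertex H) \<and>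
        first_word W H g (walk H (inverse_word g) (root_vertex H))" if g: "g \<in> W" for g
    proof -
      have gc: "g \<in> carrier (free_group n)" using W(2) g by blast
      note g' = inverse_word_carrier[OF gc]
      let ?u = "walk H (inverse_word g) (root_vertex H)"
      have "C \<in> F g \<longleftrightarrow> schreier_class n (H\<lparr>root_vertex := ?u\<rparr>) \<in> structures n (Q g)"
        using act_schreier_class[OF H(1) g'] H(2) \<open>C \<in> Lambda n\<close> by (simp add: F_def E_def space_\<mu>)
      also have "\<dots> \<longleftrightarrow> Q g (H\<lparr>root_vertex := ?u\<rparr>)"
        by (rule schreier_class_in_structures[OF closed_Q[OF g]
              schreier_walk_root[OF H(1) carrier_letters[OF g']]])
      also have "\<dots> \<longleftrightarrow> orbit_pair G x y H ?u (root_vertex H) \<and> first_word W H g ?u"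
        using walk_inverse_word(2)[OF H(1) root gc] by (simp add: Q_def first_word_def)
      finally show ?thesis .
    qed
    then have "{g \<in> W. C \<in> F g} = {g \<in> W.
        orbit_pair G x y H (walk H (inverse_word g) (root_vertex H)) (root_vertex H) \<and>
        first_word W H g (walk H (inverse_word g) (root_vertex H))}" by blast
    then have "card {g \<in> W. C \<in> F g} = card {u \<in> verts H. orbit_pair G x y H u (root_vertex H)}"
      using card_words_to[OF H(1) W(2) root, of "\<lambda>u. orbit_pair G x y H u (root_vertex H)"]
        join[OF H(1) _ root] by simp
    also have "\<dots> = card {u \<in> verts H. orbit_pair G y x H (root_vertex H) u}"
      by (subst orbit_pair_swap) (rule refl)
    also have "\<dots> = card (stabilizer_orbit G y x)"
      by (rule card_orbit_pair[OF mG G(2) xy(2,1) mH iso root])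
    finally show "card {g \<in> W. C \<in> F g} = card (stabilizer_orbit G y x)" .
  qed
  have "of_nat (card (stabilizer_orbit G x y)) = (\<Sum>g\<in>W. emeasure \<mu> (E g))"
    using in_S E_count by (intro sum_emeasure_eq_count[symmetric] W(1) E_sets) auto
  also have "\<dots> = (\<Sum>g\<in>W. emeasure \<mu> (F g))" by (simp add: EF)
  also have "\<dots> = of_nat (card (stabilizer_orbit G y x))"
    using in_S F_count by (intro sum_emeasure_eq_count W(1) F_sets) auto
  finally show ?thesis by simp
qed

theorem corollary5p5:
  fixes n :: nat
    and \<Gamma> :: "(nat, nat) rooted_graph set"
    and G :: "(nat, nat) rooted_graph"
  assumes "\<Gamma> \<in> Omega n"
    and "G \<in> \<Gamma>"
    and "infinite (verts G)"
    and "vertex_transitive G"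
    and "nonunimodular G"
  shows "closedin (Lambda_topology n) (schreier_structures n \<Gamma>) \<and>
         invariant_subspace n (schreier_structures n \<Gamma>) \<and>
         \<not> (\<exists>\<mu>. invariant_probability n \<mu> \<and> emeasure \<mu> (schreier_structures n \<Gamma>) = 1)"
proof -
  obtain G0 where G0: "\<Gamma> = Omega_rel n `` {G0}"
    using assms(1) by (auto simp: Omega_def quotient_def)
  then have rel: "(G0, G) \<in> Omega_rel n" using assms(2) by auto
  then have G: "regular_rooted_graph (2 * n) G" by (simp add: Omega_rel_def)
  have \<Gamma>: "\<Gamma> = Omega_rel n `` {G}" using equiv_class_eq[OF equiv_Omega_rel rel] G0 by simp
  obtain x y where "x \<in> verts G" "y \<in> verts G"
    "card (stabilizer_orbit G x y) \<noteq> card (stabilizer_orbit G y x)"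
    using assms(5) by (auto simp: nonunimodular_def)
  then show ?thesis
    using invariant_imp_orbits_balanced[OF G assms(4)] closedin_schreier_structures[OF G]
      invariant_subspace_schreier_structures[OF G assms(4)] unfolding \<Gamma> by blast
qed

end
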